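(* Let $\Omega\subset\mathbb{R}^N$ be an open bounded domain with smooth boundary, let $\alpha>0$, $\gamma>0$, and let $(z_0,z_1)\in (H^2(\Omega)\cap H^1_0(\Omega))\times H^1_0(\Omega)$. Consider the closed-loop system $$ \begin{cases} \partial_t^2 z-\Delta z=-\alpha\,\partial_t z+\alpha e_k & \text{in } \Omega\times[t_k,t_{k+1}),\ k\in\mathbb{N},\\ z=0 & \text{on } \partial\Omega\times\mathbb{R}^+,\\ z(\cdot,0)=z_0,\quad \partial_t z(\cdot,0)=z_1 & \text{in } \Omega, \end{cases} \qquad e_k(x,t)=\partial_t z(x,t)-\partial_t z(x,t_k), $$ under the event-triggering mechanism $t_0=0$, $$ t_{k+1}=\inf\Big\{t\ge t_k:\ \|e_k(t)\|^2>2\gamma E(t)\Big\},\qquad E(t)=\tfrac12\left(\|\partial_t z(t)\|^2+\|\nabla z(t)\|^2\right). $$ Then there is no Zeno phenomenon; equivalently, the maximal time $T$, defined by $T=+\infty$ if $(t_k)$ is a finite sequence and $T=\limsup_{k\to+\infty}t_k$ otherwise, is $T=+\infty$.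
   Context: $\|\cdot\|$ denotes the $L^2(\Omega)$ norm. A Zeno phenomenon is the occurrence of infinitely many triggering instants in a bounded time interval, i.e. a finite accumulation point of $(t_k)$. The triggering instants are generated along the solution itself: on $[t_k,t_{k+1})$ the equation is $\partial_t^2z-\Delta z=-\alpha\,\partial_t z(\cdot,t_k)$, and $z$ and $\partial_t z$ are continuous in time across the instants $t_k$. Convention: $\inf\emptyset=+\infty$. If no further event occurs after some $t_k$, the sequence of triggering instants is finite, ending at $t_k$, and the equation with source $-\alpha\,\partial_t z(\cdot,t_k)$ holds on $[t_k,+\infty)$. The solution is the unique strong solution in $C^0([0,T);H^2(\Omega)\cap H^1_0(\Omega))\cap C^1([0,T);H^1_0(\Omega))$, whose equation holds in $L^2(\Omega)$ on each $[t_k,t_{k+1})$. *)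

theory Defs
  imports "HOL-Analysis.Analysis"
begin

section \<open>Smooth functions and smoothly bounded domains\<close>

primrec C_on :: "nat \<Rightarrow> 'a::euclidean_space set \<Rightarrow> ('a \<Rightarrow> 'b::euclidean_space) \<Rightarrow> bool" where
  "C_on 0 S f \<longleftrightarrow> continuous_on S f"
| "C_on (Suc n) S f \<longleftrightarrow>
     (\<forall>x\<in>S. f differentiable (at x)) \<and>
     (\<forall>h. C_on n S (\<lambda>x. frechet_derivative f (at x) h))"

text \<open>Used for open sets only, so that derivatives are taken at interior points.\<close>

definition smooth_on :: "'a::euclidean_space set \<Rightarrow> ('a \<Rightarrow> 'b::euclidean_space) \<Rightarrow> bool" where
  "smooth_on S f \<longleftrightarrow> (\<forall>n. C_on n S f)"

text \<open>Around every boundary point a smooth diffeomorphism straightens the boundary, with the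
  set lying on one side of it.\<close>

definition smooth_boundary :: "'a::euclidean_space set \<Rightarrow> bool" where
  "smooth_boundary \<Omega> \<longleftrightarrow>
     (\<forall>p\<in>frontier \<Omega>. \<exists>U V \<Phi> \<Psi>. \<exists>b\<in>(Basis :: 'a set).
        open U \<and> p \<in> U \<and> open V \<and> homeomorphism U V \<Phi> \<Psi> \<and>
        smooth_on U \<Phi> \<and> smooth_on V \<Psi> \<and>
        \<Phi> ` (U \<inter> \<Omega>) = {y\<in>V. y \<bullet> b > 0} \<and>
        \<Phi> ` (U \<inter> frontier \<Omega>) = {y\<in>V. y \<bullet> b = 0})"

definition bounded_smooth_domain :: "'a::euclidean_space set \<Rightarrow> bool" where
  "bounded_smooth_domain \<Omega> \<longleftrightarrow>
     open \<Omega> \<and> connected \<Omega> \<and> \<Omega> \<noteq> {} \<and> bounded \<Omega> \<and> smooth_boundary \<Omega>"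


section \<open>Lebesgue and Sobolev spaces\<close>

text \<open>Elements of these spaces are given by representatives; only their values almost everywhere
  in \<open>\<Omega>\<close> matter. The norms are meaningful only for members of the respective space, since
  the Bochner integral of a non-integrable function is 0.\<close>

definition in_L2 :: "'a::euclidean_space set \<Rightarrow> ('a \<Rightarrow> 'b::euclidean_space) \<Rightarrow> bool" where
  "in_L2 \<Omega> f \<longleftrightarrow> f \<in> borel_measurable (lebesgue_on \<Omega>) \<and>
     integrable (lebesgue_on \<Omega>) (\<lambda>x. (norm (f x))\<^sup>2)"

definition L2_norm :: "'a::euclidean_space set \<Rightarrow> ('a \<Rightarrow> 'b::euclidean_space) \<Rightarrow> real" where
  "L2_norm \<Omega> f = sqrt (\<integral>x. (norm (f x))\<^sup>2 \<partial>lebesgue_on \<Omega>)"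

definition test_function :: "'a::euclidean_space set \<Rightarrow> ('a \<Rightarrow> real) \<Rightarrow> bool" where
  "test_function \<Omega> \<phi> \<longleftrightarrow> smooth_on UNIV \<phi> \<and>
     compact (closure {x. \<phi> x \<noteq> 0}) \<and> closure {x. \<phi> x \<noteq> 0} \<subseteq> \<Omega>"

definition has_weak_gradient ::
    "'a::euclidean_space set \<Rightarrow> ('a \<Rightarrow> real) \<Rightarrow> ('a \<Rightarrow> 'a) \<Rightarrow> bool" where
  "has_weak_gradient \<Omega> f G \<longleftrightarrow> in_L2 \<Omega> f \<and> in_L2 \<Omega> G \<and>
     (\<forall>\<phi>. test_function \<Omega> \<phi> \<longrightarrow> (\<forall>i\<in>Basis.
        (\<integral>x. f x * frechet_derivative \<phi> (at x) i \<partial>lebesgue_on \<Omega>)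
        = - (\<integral>x. (G x \<bullet> i) * \<phi> x \<partial>lebesgue_on \<Omega>)))"

definition in_H1 :: "'a::euclidean_space set \<Rightarrow> ('a \<Rightarrow> real) \<Rightarrow> bool" where
  "in_H1 \<Omega> f \<longleftrightarrow> (\<exists>G. has_weak_gradient \<Omega> f G)"

text \<open>Weak gradients are unique almost everywhere; \<open>SOME\<close> picks a representative.\<close>

definition grad :: "'a::euclidean_space set \<Rightarrow> ('a \<Rightarrow> real) \<Rightarrow> 'a \<Rightarrow> 'a" where
  "grad \<Omega> f = (SOME G. has_weak_gradient \<Omega> f G)"

definition partial :: "'a::euclidean_space set \<Rightarrow> 'a \<Rightarrow> ('a \<Rightarrow> real) \<Rightarrow> 'a \<Rightarrow> real" where
  "partial \<Omega> i f = (\<lambda>x. grad \<Omega> f x \<bullet> i)"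

definition laplacian :: "'a::euclidean_space set \<Rightarrow> ('a \<Rightarrow> real) \<Rightarrow> 'a \<Rightarrow> real" where
  "laplacian \<Omega> f = (\<lambda>x. \<Sum>i\<in>Basis. partial \<Omega> i (partial \<Omega> i f) x)"

definition in_H2 :: "'a::euclidean_space set \<Rightarrow> ('a \<Rightarrow> real) \<Rightarrow> bool" where
  "in_H2 \<Omega> f \<longleftrightarrow> in_H1 \<Omega> f \<and> (\<forall>i\<in>Basis. in_H1 \<Omega> (partial \<Omega> i f))"

definition H1_norm :: "'a::euclidean_space set \<Rightarrow> ('a \<Rightarrow> real) \<Rightarrow> real" where
  "H1_norm \<Omega> f = sqrt ((L2_norm \<Omega> f)\<^sup>2 + (L2_norm \<Omega> (grad \<Omega> f))\<^sup>2)"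

definition H2_norm :: "'a::euclidean_space set \<Rightarrow> ('a \<Rightarrow> real) \<Rightarrow> real" where
  "H2_norm \<Omega> f = sqrt ((L2_norm \<Omega> f)\<^sup>2 + (L2_norm \<Omega> (grad \<Omega> f))\<^sup>2
     + (\<Sum>i\<in>Basis. (L2_norm \<Omega> (grad \<Omega> (partial \<Omega> i f)))\<^sup>2))"

definition in_H10 :: "'a::euclidean_space set \<Rightarrow> ('a \<Rightarrow> real) \<Rightarrow> bool" where
  "in_H10 \<Omega> f \<longleftrightarrow> in_H1 \<Omega> f \<and>
     (\<exists>\<phi>. (\<forall>n. test_function \<Omega> (\<phi> n)) \<and> (\<lambda>n. H1_norm \<Omega> (\<lambda>x. \<phi> n x - f x)) \<longlonglongrightarrow> 0)"


section \<open>Functions of time with values in a function space\<close>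

text \<open>The norm \<open>nrm\<close> of the function space is passed explicitly, as the spaces are not types.\<close>

definition time_continuous_on ::
    "(('a \<Rightarrow> real) \<Rightarrow> real) \<Rightarrow> real set \<Rightarrow> (real \<Rightarrow> 'a \<Rightarrow> real) \<Rightarrow> bool" where
  "time_continuous_on nrm I u \<longleftrightarrow>
     (\<forall>s\<in>I. ((\<lambda>r. nrm (\<lambda>x. u r x - u s x)) \<longlongrightarrow> 0) (at s within I))"

definition has_time_derivative ::
    "(('a \<Rightarrow> real) \<Rightarrow> real) \<Rightarrow> (real \<Rightarrow> 'a \<Rightarrow> real) \<Rightarrow> ('a \<Rightarrow> real) \<Rightarrow> real \<Rightarrow> real set \<Rightarrow> bool" where
  "has_time_derivative nrm u w s I \<longleftrightarrow>
     ((\<lambda>r. nrm (\<lambda>x. (u r x - u s x) / (r - s) - w x)) \<longlongrightarrow> 0) (at s within I)"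

text \<open>\<open>z\<close> belongs to \<open>C\<^sup>0(I; H\<^sup>2 \<inter> H\<^sup>1\<^sub>0) \<inter> C\<^sup>1(I; H\<^sup>1\<^sub>0)\<close> and has time derivative \<open>v\<close>. The Dirichlet
  condition on \<open>\<partial>\<Omega>\<close> is the membership in \<open>H\<^sup>1\<^sub>0\<close>.\<close>

definition strong_regularity ::
    "'a::euclidean_space set \<Rightarrow> real set \<Rightarrow> (real \<Rightarrow> 'a \<Rightarrow> real) \<Rightarrow> (real \<Rightarrow> 'a \<Rightarrow> real) \<Rightarrow> bool" where
  "strong_regularity \<Omega> I z v \<longleftrightarrow>
     (\<forall>s\<in>I. in_H2 \<Omega> (z s) \<and> in_H10 \<Omega> (z s)) \<and> time_continuous_on (H2_norm \<Omega>) I z \<and>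
     (\<forall>s\<in>I. in_H10 \<Omega> (v s)) \<and> time_continuous_on (H1_norm \<Omega>) I v \<and>
     (\<forall>s\<in>I. has_time_derivative (H1_norm \<Omega>) z (v s) s I)"

definition ae_eq :: "'a::euclidean_space set \<Rightarrow> ('a \<Rightarrow> real) \<Rightarrow> ('a \<Rightarrow> real) \<Rightarrow> bool" where
  "ae_eq \<Omega> f g \<longleftrightarrow> (AE x in lebesgue_on \<Omega>. f x = g x)"


section \<open>The event-triggered damped wave equation\<close>

text \<open>Here \<open>\<tau>\<close> is the last triggering instant and \<open>v = \<partial>\<^sub>t z\<close>.\<close>

definition sampling_error :: "(real \<Rightarrow> 'a \<Rightarrow> real) \<Rightarrow> real \<Rightarrow> real \<Rightarrow> 'a \<Rightarrow> real" where
  "sampling_error v \<tau> s = (\<lambda>x. v s x - v \<tau> x)"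

definition energy :: "'a::euclidean_space set \<Rightarrow> ('a \<Rightarrow> real) \<Rightarrow> ('a \<Rightarrow> real) \<Rightarrow> real" where
  "energy \<Omega> z v = ((L2_norm \<Omega> v)\<^sup>2 + (L2_norm \<Omega> (grad \<Omega> z))\<^sup>2) / 2"

definition sampled_wave_equation_on ::
    "'a::euclidean_space set \<Rightarrow> real \<Rightarrow> real \<Rightarrow> real set \<Rightarrow>
     (real \<Rightarrow> 'a \<Rightarrow> real) \<Rightarrow> (real \<Rightarrow> 'a \<Rightarrow> real) \<Rightarrow> bool" where
  "sampled_wave_equation_on \<Omega> \<alpha> \<tau> J z v \<longleftrightarrow>
     (\<forall>s\<in>J. \<exists>a. in_L2 \<Omega> a \<and> has_time_derivative (L2_norm \<Omega>) v a s J \<and>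
        ae_eq \<Omega> (\<lambda>x. a x - laplacian \<Omega> (z s) x)
                (\<lambda>x. - \<alpha> * v s x + \<alpha> * sampling_error v \<tau> s x))"

definition next_event ::
    "'a::euclidean_space set \<Rightarrow> real \<Rightarrow> real \<Rightarrow>
     (real \<Rightarrow> 'a \<Rightarrow> real) \<Rightarrow> (real \<Rightarrow> 'a \<Rightarrow> real) \<Rightarrow> ereal" where
  "next_event \<Omega> \<gamma> \<tau> z v =
     Inf {ereal s | s. \<tau> \<le> s \<and> (L2_norm \<Omega> (sampling_error v \<tau> s))\<^sup>2 > 2 * \<gamma> * energy \<Omega> (z s) (v s)}"

text \<open>A finite sequence of triggering instants is padded with \<open>\<infinity>\<close>.\<close>

definition maximal_time :: "(nat \<Rightarrow> ereal) \<Rightarrow> ereal" where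
  "maximal_time t = (if \<exists>k. t k = \<infinity> then \<infinity> else limsup t)"

definition zeno :: "(nat \<Rightarrow> ereal) \<Rightarrow> bool" where
  "zeno t \<longleftrightarrow> (\<exists>B::real. infinite {k. t k \<le> ereal B})"

text \<open>\<open>z\<close>, with \<open>v = \<partial>\<^sub>t z\<close>, is the closed-loop solution on \<open>[0, T)\<close> and \<open>t\<close> its sequence of
  triggering instants. Whether the inequality is violated immediately after \<open>t\<^bsub>k+1\<^esub>\<close> concerns the
  trajectory with the input held at \<open>-\<alpha> \<partial>\<^sub>t z(t\<^sub>k)\<close>, whereas \<open>z\<close> itself switches to a new input at
  \<open>t\<^bsub>k+1\<^esub>\<close>. The infimum is therefore evaluated along the prolongation \<open>(\<zeta>, \<nu>)\<close> of the \<open>k\<close>-th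
  piece of \<open>(z, v)\<close> to \<open>[t\<^sub>k, \<infinity>)\<close> with unchanged input.\<close>

definition closed_loop_solution ::
    "'a::euclidean_space set \<Rightarrow> real \<Rightarrow> real \<Rightarrow> ('a \<Rightarrow> real) \<Rightarrow> ('a \<Rightarrow> real) \<Rightarrow>
     (nat \<Rightarrow> ereal) \<Rightarrow> (real \<Rightarrow> 'a \<Rightarrow> real) \<Rightarrow> (real \<Rightarrow> 'a \<Rightarrow> real) \<Rightarrow> bool" where
  "closed_loop_solution \<Omega> \<alpha> \<gamma> z0 z1 t z v \<longleftrightarrow>
     strong_regularity \<Omega> {s. 0 \<le> s \<and> ereal s < maximal_time t} z v \<and>
     ae_eq \<Omega> (z 0) z0 \<and> ae_eq \<Omega> (v 0) z1 \<and>
     t 0 = 0 \<and>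
     (\<forall>k. t k = \<infinity> \<longrightarrow> t (Suc k) = \<infinity>) \<and>
     (\<forall>k \<tau>. t k = ereal \<tau> \<longrightarrow>
        sampled_wave_equation_on \<Omega> \<alpha> \<tau> {s. \<tau> \<le> s \<and> ereal s < t (Suc k)} z v \<and>
        (\<exists>\<zeta> \<nu>. strong_regularity \<Omega> {\<tau>..} \<zeta> \<nu> \<and>
           sampled_wave_equation_on \<Omega> \<alpha> \<tau> {\<tau>..} \<zeta> \<nu> \<and>
           (\<forall>s. \<tau> \<le> s \<and> ereal s \<le> t (Suc k) \<longrightarrow> ae_eq \<Omega> (\<zeta> s) (z s) \<and> ae_eq \<Omega> (\<nu> s) (v s)) \<and>
           t (Suc k) = next_event \<Omega> \<gamma> \<tau> \<zeta> \<nu>))"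

end

theory Submission
  imports Defs
begin

text \<open>Let \<open>U(t) = (\<partial>\<^sub>t z(t), \<nabla>z(t))\<close>, whose squared \<open>L\<^sup>2\<close> norm is \<open>2E(t)\<close>. Green's formula shows
  that the norm of the state of a wave equation with constant source \<open>f\<close> is Lipschitz in time with constant \<open>\<parallel>f\<parallel>\<close>;
  the same holds for differences of solutions. Suppose that \<open>t\<^sub>k \<longlonglongrightarrow> T < \<infinity>\<close>. The source on the \<open>k\<close>-th
  interval has norm at most \<open>\<alpha> \<parallel>U(t\<^sub>k)\<parallel>\<close>, so for \<open>K\<close> large all \<open>\<parallel>U(t\<^sub>j)\<parallel>\<close>, \<open>j \<ge> K\<close>, are comparable to
  \<open>\<parallel>U(t\<^sub>K)\<parallel>\<close>, which is positive because no event follows a state of rest. Moreover \<open>U\<close> stays within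
  \<open>O(\<alpha> (T - t\<^sub>K)) \<parallel>U(t\<^sub>K)\<parallel>\<close> of the prolongation of the \<open>K\<close>-th piece, and that prolongation is
  continuous at \<open>T\<close>. Hence \<open>\<parallel>U(t\<^bsub>j+1\<^esub>) - U(t\<^sub>j)\<parallel>\<close> eventually drops below any fixed fraction of
  \<open>\<parallel>U(t\<^sub>K)\<parallel>\<close>, whereas the triggering rule forces it to be at least \<open>\<surd>\<gamma> \<parallel>U(t\<^bsub>j+1\<^esub>)\<parallel>\<close>.\<close>

section \<open>Square-integrable functions\<close>

definition L2_inner :: "'a::euclidean_space set \<Rightarrow> ('a \<Rightarrow> 'b::euclidean_space) \<Rightarrow> ('a \<Rightarrow> 'b) \<Rightarrow> real" where
  "L2_inner \<Omega> f g = (\<integral>x. f x \<bullet> g x \<partial>lebesgue_on \<Omega>)"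

lemma in_L2D:
  assumes "in_L2 \<Omega> f"
  shows in_L2_measurable: "f \<in> borel_measurable (lebesgue_on \<Omega>)"
    and in_L2_integrable: "integrable (lebesgue_on \<Omega>) (\<lambda>x. (norm (f x))\<^sup>2)"
  using assms by (auto simp: in_L2_def)

lemma in_L2_norm_bound:
  assumes "f \<in> borel_measurable (lebesgue_on \<Omega>)" "integrable (lebesgue_on \<Omega>) g"
    and "\<And>x. (norm (f x))\<^sup>2 \<le> g x"
  shows "in_L2 \<Omega> f"
proof -
  have [measurable]: "f \<in> borel_measurable (lebesgue_on \<Omega>)" by fact
  have "integrable (lebesgue_on \<Omega>) (\<lambda>x. (norm (f x))\<^sup>2)"
    by (rule Bochner_Integration.integrable_bound[OF assms(2)])
       (use assms(3) in \<open>auto intro!: AE_I2 order_trans[OF _ abs_ge_self]\<close>)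
  then show ?thesis using assms(1) by (simp add: in_L2_def)
qed

lemma norm_add_sq_le: "(norm (a + b :: 'a::real_inner))\<^sup>2 \<le> 2 * (norm a)\<^sup>2 + 2 * (norm b)\<^sup>2"
proof -
  have "(norm (a + b))\<^sup>2 + (norm (a - b))\<^sup>2 = 2 * (norm a)\<^sup>2 + 2 * (norm b)\<^sup>2"
    by (simp add: power2_norm_eq_inner algebra_simps inner_commute)
  then show ?thesis by (smt (verit) zero_le_power2)
qed

lemma in_L2_add [intro]:
  assumes "in_L2 \<Omega> f" "in_L2 \<Omega> g"
  shows "in_L2 \<Omega> (\<lambda>x. f x + g x)"
proof -
  note [measurable] = in_L2_measurable[OF assms(1)] in_L2_measurable[OF assms(2)]
  show ?thesis
    by (rule in_L2_norm_bound[where g = "\<lambda>x. 2 * (norm (f x))\<^sup>2 + 2 * (norm (g x))\<^sup>2"])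
       (use assms[THEN in_L2_integrable] norm_add_sq_le in auto)
qed

lemma in_L2_scaleR [intro]:
  assumes "in_L2 \<Omega> f"
  shows "in_L2 \<Omega> (\<lambda>x. c *\<^sub>R f x)"
proof -
  note [measurable] = in_L2_measurable[OF assms]
  show ?thesis
    by (rule in_L2_norm_bound[where g = "\<lambda>x. c\<^sup>2 * (norm (f x))\<^sup>2"])
       (use in_L2_integrable[OF assms] in \<open>auto simp: power_mult_distrib\<close>)
qed

lemma in_L2_diff [intro]:
  assumes "in_L2 \<Omega> f" "in_L2 \<Omega> g"
  shows "in_L2 \<Omega> (\<lambda>x. f x - g x)"
  using in_L2_add[OF assms(1) in_L2_scaleR[OF assms(2), of "-1"]] by simp

lemma in_L2_Pair:
  assumes "in_L2 \<Omega> f" "in_L2 \<Omega> g"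
  shows "in_L2 \<Omega> (\<lambda>x. (f x, g x))"
proof -
  note [measurable] = in_L2_measurable[OF assms(1)] in_L2_measurable[OF assms(2)]
  show ?thesis
    by (rule in_L2_norm_bound[where g = "\<lambda>x. (norm (f x))\<^sup>2 + (norm (g x))\<^sup>2"])
       (use assms[THEN in_L2_integrable] in \<open>auto simp: norm_Pair\<close>)
qed

lemma in_L2_inner_const:
  assumes "in_L2 \<Omega> f"
  shows "in_L2 \<Omega> (\<lambda>x. f x \<bullet> c)"
proof -
  note [measurable] = in_L2_measurable[OF assms(1)]
  show ?thesis
    by (rule in_L2_norm_bound[where g = "\<lambda>x. (norm (f x))\<^sup>2 * (norm c)\<^sup>2"])
       (use in_L2_integrable[OF assms] Cauchy_Schwarz_ineq[of _ c] in
          \<open>simp_all add: power2_norm_eq_inner[symmetric]\<close>)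
qed

lemma in_L2_zero [intro, simp]: "in_L2 \<Omega> (\<lambda>x. 0)"
  by (simp add: in_L2_def)

lemma in_L2_sum: "(\<And>i. i \<in> I \<Longrightarrow> in_L2 \<Omega> (f i)) \<Longrightarrow> in_L2 \<Omega> (\<lambda>x. \<Sum>i\<in>I. f i x)"
  by (induction I rule: infinite_finite_induct) (simp_all add: in_L2_add)

lemma integrable_inner_L2 [intro]:
  assumes "in_L2 \<Omega> f" "in_L2 \<Omega> g"
  shows "integrable (lebesgue_on \<Omega>) (\<lambda>x. f x \<bullet> g x)"
proof -
  note [measurable] = in_L2_measurable[OF assms(1)] in_L2_measurable[OF assms(2)]
  have "\<bar>f x \<bullet> g x\<bar> \<le> \<bar>(norm (f x))\<^sup>2 + (norm (g x))\<^sup>2\<bar>" for x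
  proof -
    have "\<bar>f x \<bullet> g x\<bar> \<le> norm (f x) * norm (g x)" by (rule Cauchy_Schwarz_ineq2)
    moreover have "2 * (norm (f x) * norm (g x)) \<le> (norm (f x))\<^sup>2 + (norm (g x))\<^sup>2"
      using sum_squares_bound[of "norm (f x)" "norm (g x)"] by (simp only: mult.assoc)
    moreover have "0 \<le> norm (f x) * norm (g x)" by simp
    ultimately show ?thesis by linarith
  qed
  then show ?thesis
    by (intro Bochner_Integration.integrable_bound[OF Bochner_Integration.integrable_add[OF
          assms[THEN in_L2_integrable]]] AE_I2) simp_all
qed

lemma L2_inner_add:
  assumes "in_L2 \<Omega> f" "in_L2 \<Omega> g" "in_L2 \<Omega> h"
  shows L2_inner_add_left: "L2_inner \<Omega> (\<lambda>x. f x + g x) h = L2_inner \<Omega> f h + L2_inner \<Omega> g h"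
    and L2_inner_add_right: "L2_inner \<Omega> h (\<lambda>x. f x + g x) = L2_inner \<Omega> h f + L2_inner \<Omega> h g"
  unfolding L2_inner_def inner_add_left inner_add_right
  by (rule Bochner_Integration.integral_add; use assms in blast)+

lemma L2_inner_diff:
  assumes "in_L2 \<Omega> f" "in_L2 \<Omega> g" "in_L2 \<Omega> h"
  shows L2_inner_diff_left: "L2_inner \<Omega> (\<lambda>x. f x - g x) h = L2_inner \<Omega> f h - L2_inner \<Omega> g h"
    and L2_inner_diff_right: "L2_inner \<Omega> h (\<lambda>x. f x - g x) = L2_inner \<Omega> h f - L2_inner \<Omega> h g"
  unfolding L2_inner_def inner_diff_left inner_diff_right
  by (rule Bochner_Integration.integral_diff; use assms in blast)+

lemma L2_inner_scaleR_left: "L2_inner \<Omega> (\<lambda>x. c *\<^sub>R f x) h = c * L2_inner \<Omega> f h"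
  and L2_inner_scaleR_right: "L2_inner \<Omega> h (\<lambda>x. c *\<^sub>R f x) = c * L2_inner \<Omega> h f"
  by (simp_all add: L2_inner_def)

lemma L2_inner_commute: "L2_inner \<Omega> f g = L2_inner \<Omega> g f"
  by (simp add: L2_inner_def inner_commute)

lemma L2_norm_nonneg [simp]: "0 \<le> L2_norm \<Omega> f"
  by (simp add: L2_norm_def)

lemma L2_norm_sq: "(L2_norm \<Omega> f)\<^sup>2 = L2_inner \<Omega> f f"
  by (simp add: L2_norm_def L2_inner_def power2_norm_eq_inner)

lemma L2_norm_zero [simp]: "L2_norm \<Omega> (\<lambda>x. 0) = 0"
  by (simp add: L2_norm_def)

lemma L2_norm_cong_AE:
  assumes "in_L2 \<Omega> f" "in_L2 \<Omega> g" "AE x in lebesgue_on \<Omega>. f x = g x"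
  shows "L2_norm \<Omega> f = L2_norm \<Omega> g"
proof -
  note [measurable] = in_L2_measurable[OF assms(1)] in_L2_measurable[OF assms(2)]
  show ?thesis unfolding L2_norm_def
    by (intro arg_cong[where f = sqrt] integral_cong_AE) (use assms(3) in auto)
qed

lemma L2_inner_cong_AE:
  assumes "in_L2 \<Omega> f" "in_L2 \<Omega> g" "in_L2 \<Omega> h" "AE x in lebesgue_on \<Omega>. f x = g x"
  shows "L2_inner \<Omega> f h = L2_inner \<Omega> g h"
proof -
  note [measurable] = assms(1-3)[THEN in_L2_measurable]
  show ?thesis unfolding L2_inner_def
    by (intro integral_cong_AE) (use assms(4) in auto)
qed

lemma L2_norm_add_sq:
  assumes "in_L2 \<Omega> f" "in_L2 \<Omega> g"
  shows "(L2_norm \<Omega> (\<lambda>x. f x + g x))\<^sup>2 = (L2_norm \<Omega> f)\<^sup>2 + 2 * L2_inner \<Omega> f g + (L2_norm \<Omega> g)\<^sup>2"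
  using L2_inner_add_left[OF assms in_L2_add[OF assms]] L2_inner_add_right[OF assms assms(1)]
    L2_inner_add_right[OF assms assms(2)] L2_inner_commute[of \<Omega> g f]
  by (simp add: L2_norm_sq)

lemma L2_norm_scaleR: "L2_norm \<Omega> (\<lambda>x. c *\<^sub>R f x) = \<bar>c\<bar> * L2_norm \<Omega> f"
  by (simp add: L2_norm_def power_mult_distrib real_sqrt_mult)

text \<open>The form is only semidefinite on representatives, so the argument uses nonnegativity of
  the quadratic form \<open>pos\<close> in both variables s and t and treats a vanishing A
  separately, without normalising f.\<close>

lemma L2_Cauchy_Schwarz:
  assumes "in_L2 \<Omega> f" "in_L2 \<Omega> g"
  shows "\<bar>L2_inner \<Omega> f g\<bar> \<le> L2_norm \<Omega> f * L2_norm \<Omega> g"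
proof -
  define A B C where "A = L2_inner \<Omega> f f" and "B = L2_inner \<Omega> f g" and "C = L2_inner \<Omega> g g"
  have pos: "0 \<le> s\<^sup>2 * A + 2 * s * t * B + t\<^sup>2 * C" for s t
  proof -
    have "0 \<le> (L2_norm \<Omega> (\<lambda>x. s *\<^sub>R f x + t *\<^sub>R g x))\<^sup>2" by simp
    also have "\<dots> = s\<^sup>2 * A + 2 * s * t * B + t\<^sup>2 * C"
      unfolding L2_norm_add_sq[OF in_L2_scaleR[OF assms(1)] in_L2_scaleR[OF assms(2)]]
      by (simp add: L2_norm_scaleR L2_inner_scaleR_left L2_inner_scaleR_right
          power_mult_distrib A_def B_def C_def L2_norm_sq)
    finally show ?thesis .
  qed
  have "A \<ge> 0" unfolding A_def L2_norm_sq[symmetric] by simp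
  have "B\<^sup>2 \<le> A * C"
  proof (cases "A = 0")
    case True
    have "B = 0"
    proof (rule ccontr)
      assume "B \<noteq> 0"
      \<comment> \<open>With A = 0 this choice of s makes the form equal to -(C + 1) + C =
        -1.\<close>
      then show False using pos[of "-(C+1)/(2*B)" 1] True by (simp add: field_simps)
    qed
    then show ?thesis using True by simp
  next
    case False
    have "0 \<le> A * (A * C - B\<^sup>2)"
      \<comment> \<open>At s = -B, t = A the form factors as A times the discriminant term.\<close>
      using pos[of "-B" A] by (simp add: power2_eq_square algebra_simps)
    then show ?thesis using False \<open>A \<ge> 0\<close> by (simp add: zero_le_mult_iff)
  qed
  then have "B\<^sup>2 \<le> (L2_norm \<Omega> f * L2_norm \<Omega> g)\<^sup>2"
    by (simp add: power_mult_distrib L2_norm_sq A_def C_def)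
  then show ?thesis unfolding B_def by (simp add: abs_le_square_iff[symmetric])
qed

lemma L2_norm_triangle:
  assumes "in_L2 \<Omega> f" "in_L2 \<Omega> g"
  shows "L2_norm \<Omega> (\<lambda>x. f x + g x) \<le> L2_norm \<Omega> f + L2_norm \<Omega> g"
proof (rule power2_le_imp_le)
  have "(L2_norm \<Omega> (\<lambda>x. f x + g x))\<^sup>2 = (L2_norm \<Omega> f)\<^sup>2 + 2 * L2_inner \<Omega> f g + (L2_norm \<Omega> g)\<^sup>2"
    by (rule L2_norm_add_sq[OF assms])
  also have "\<dots> \<le> (L2_norm \<Omega> f + L2_norm \<Omega> g)\<^sup>2"
    using L2_Cauchy_Schwarz[OF assms] by (simp add: power2_sum)
  finally show "(L2_norm \<Omega> (\<lambda>x. f x + g x))\<^sup>2 \<le> (L2_norm \<Omega> f + L2_norm \<Omega> g)\<^sup>2" .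
qed simp

lemma L2_norm_minus_commute: "L2_norm \<Omega> (\<lambda>x. f x - g x) = L2_norm \<Omega> (\<lambda>x. g x - f x)"
  by (simp add: L2_norm_def norm_minus_commute)

lemma L2_norm_triangle_diff:
  assumes "in_L2 \<Omega> f" "in_L2 \<Omega> g"
  shows "L2_norm \<Omega> (\<lambda>x. f x - g x) \<le> L2_norm \<Omega> f + L2_norm \<Omega> g"
  using L2_norm_triangle[OF assms(1) in_L2_scaleR[OF assms(2), of "-1"]]
  by (simp add: L2_norm_def)

lemma L2_dist_triangle:
  assumes "in_L2 \<Omega> f" "in_L2 \<Omega> g" "in_L2 \<Omega> h"
  shows "L2_norm \<Omega> (\<lambda>x. f x - h x) \<le> L2_norm \<Omega> (\<lambda>x. f x - g x) + L2_norm \<Omega> (\<lambda>x. g x - h x)"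
  using L2_norm_triangle[OF in_L2_diff[OF assms(1,2)] in_L2_diff[OF assms(2,3)]] by simp

lemma L2_norm_Pair_sq:
  assumes "in_L2 \<Omega> f" "in_L2 \<Omega> g"
  shows "(L2_norm \<Omega> (\<lambda>x. (f x, g x)))\<^sup>2 = (L2_norm \<Omega> f)\<^sup>2 + (L2_norm \<Omega> g)\<^sup>2"
  using assms by (simp add: L2_norm_sq L2_inner_def integrable_inner_L2)

lemma L2_norm_fst_le_Pair:
  assumes "in_L2 \<Omega> f" "in_L2 \<Omega> g"
  shows "L2_norm \<Omega> f \<le> L2_norm \<Omega> (\<lambda>x. (f x, g x))"
  by (rule power2_le_imp_le) (use L2_norm_Pair_sq[OF assms] in auto)

text \<open>Counterpart of \<open>has_time_derivative (L2_norm \<Omega>)\<close> for functions with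
  values in any Euclidean space; the states used later take values in
  \<open>real \<times> 'a\<close>.\<close>

definition has_L2_derivative ::
    "'a::euclidean_space set \<Rightarrow> (real \<Rightarrow> 'a \<Rightarrow> 'b::euclidean_space) \<Rightarrow> ('a \<Rightarrow> 'b) \<Rightarrow> real \<Rightarrow> real set \<Rightarrow> bool" where
  "has_L2_derivative \<Omega> U A s I \<longleftrightarrow>
     ((\<lambda>r. L2_norm \<Omega> (\<lambda>x. (U r x - U s x) /\<^sub>R (r - s) - A x)) \<longlongrightarrow> 0) (at s within I)"

lemma has_L2_derivative_diff:
  assumes "has_L2_derivative \<Omega> U A s I" "has_L2_derivative \<Omega> V B s I"
    and U: "\<And>r. r \<in> I \<Longrightarrow> in_L2 \<Omega> (U r)" and V: "\<And>r. r \<in> I \<Longrightarrow> in_L2 \<Omega> (V r)"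
    and AB: "in_L2 \<Omega> A" "in_L2 \<Omega> B" and "s \<in> I"
  shows "has_L2_derivative \<Omega> (\<lambda>r x. U r x - V r x) (\<lambda>x. A x - B x) s I"
  unfolding has_L2_derivative_def
proof (rule tendsto_sandwich[OF _ _ tendsto_const])
  let ?R = "\<lambda>U A r x. (U r x - U s x) /\<^sub>R (r - s) - A x"
  show "((\<lambda>r. L2_norm \<Omega> (?R U A r) + L2_norm \<Omega> (?R V B r)) \<longlongrightarrow> 0) (at s within I)"
    using tendsto_add[OF assms(1,2)[unfolded has_L2_derivative_def]] by simp
  show "\<forall>\<^sub>F r in at s within I. L2_norm \<Omega> (\<lambda>x. (U r x - V r x - (U s x - V s x)) /\<^sub>R (r - s) - (A x - B x))
      \<le> L2_norm \<Omega> (?R U A r) + L2_norm \<Omega> (?R V B r)"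
    unfolding eventually_at_filter
  proof (intro always_eventually allI impI)
    fix r assume "r \<in> I"
    then have "in_L2 \<Omega> (?R U A r)" "in_L2 \<Omega> (?R V B r)"
      using U V AB \<open>s \<in> I\<close> by (auto intro!: in_L2_diff in_L2_scaleR)
    from L2_norm_triangle_diff[OF this]
    show "L2_norm \<Omega> (\<lambda>x. (U r x - V r x - (U s x - V s x)) /\<^sub>R (r - s) - (A x - B x))
      \<le> L2_norm \<Omega> (?R U A r) + L2_norm \<Omega> (?R V B r)"
      by (simp add: scaleR_diff_right algebra_simps)
  qed
qed simp

text \<open>Write U(r) = U(s) + (r - s)(A + R) with a remainder R that tends to 0 in norm, and
  expand the square. The quotient then differs from its claimed limit by twice the inner product of
  U(s) and R plus (r - s) times the squared norm of A + R.\<close>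

lemma L2_norm_sq_has_derivative:
  assumes der: "has_L2_derivative \<Omega> U A s I"
    and U: "\<And>r. r \<in> I \<Longrightarrow> in_L2 \<Omega> (U r)" and A: "in_L2 \<Omega> A" and s: "s \<in> I"
  shows "((\<lambda>r. (L2_norm \<Omega> (U r))\<^sup>2) has_real_derivative 2 * L2_inner \<Omega> (U s) A) (at s within I)"
  unfolding has_field_derivative_iff
proof (rule LIM_zero_cancel, rule tendsto_rabs_zero_cancel, rule tendsto_sandwich[OF _ _ tendsto_const])
  let ?R = "\<lambda>r x. (U r x - U s x) /\<^sub>R (r - s) - A x"
  let ?B = "\<lambda>r. 2 * (L2_norm \<Omega> (U s) * L2_norm \<Omega> (?R r))
              + \<bar>r - s\<bar> * (L2_norm \<Omega> A + L2_norm \<Omega> (?R r))\<^sup>2"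
  note * = der[unfolded has_L2_derivative_def]
  have "(?B \<longlongrightarrow> 2 * (L2_norm \<Omega> (U s) * 0) + \<bar>s - s\<bar> * (L2_norm \<Omega> A + 0)\<^sup>2) (at s within I)"
    by (intro tendsto_intros *)
  then show "(?B \<longlongrightarrow> 0) (at s within I)" by simp
  show "\<forall>\<^sub>F r in at s within I. \<bar>((L2_norm \<Omega> (U r))\<^sup>2 - (L2_norm \<Omega> (U s))\<^sup>2) / (r - s)
       - 2 * L2_inner \<Omega> (U s) A\<bar> \<le> ?B r"
    unfolding eventually_at_filter
  proof (intro always_eventually allI impI)
    fix r assume "r \<noteq> s" "r \<in> I"
    define R where "R = ?R r"
    have quotient: "(x - y) / d - 2 * p = 2 * q + d * e"
      if "x = y + 2 * (d * (p + q)) + d\<^sup>2 * e" "d \<noteq> 0" for x y d p q e :: real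
      using that by (simp add: field_simps power2_eq_square)
    have R: "in_L2 \<Omega> R" unfolding R_def
      using U \<open>r \<in> I\<close> s A by (auto intro!: in_L2_diff in_L2_scaleR)
    have AR: "in_L2 \<Omega> (\<lambda>x. A x + R x)" using A R by blast
    have Us: "in_L2 \<Omega> (U s)" using U s by blast
    have eq: "U r = (\<lambda>x. U s x + (r - s) *\<^sub>R (A x + R x))"
      using \<open>r \<noteq> s\<close> by (auto simp: R_def)
    have "(L2_norm \<Omega> (U r))\<^sup>2 = (L2_norm \<Omega> (U s))\<^sup>2
       + 2 * ((r - s) * (L2_inner \<Omega> (U s) A + L2_inner \<Omega> (U s) R))
       + (r - s)\<^sup>2 * (L2_norm \<Omega> (\<lambda>x. A x + R x))\<^sup>2"
      using arg_cong[OF eq, of "\<lambda>f. (L2_norm \<Omega> f)\<^sup>2"]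
      by (simp only: L2_norm_add_sq[OF Us in_L2_scaleR[OF AR]] L2_norm_scaleR
          L2_inner_scaleR_right L2_inner_add_right[OF A R Us] power_mult_distrib power2_abs)
    then have "((L2_norm \<Omega> (U r))\<^sup>2 - (L2_norm \<Omega> (U s))\<^sup>2) / (r - s) - 2 * L2_inner \<Omega> (U s) A
        = 2 * L2_inner \<Omega> (U s) R + (r - s) * (L2_norm \<Omega> (\<lambda>x. A x + R x))\<^sup>2"
      by (rule quotient) (use \<open>r \<noteq> s\<close> in simp)
    also have "\<bar>\<dots>\<bar> \<le> 2 * \<bar>L2_inner \<Omega> (U s) R\<bar> + \<bar>r - s\<bar> * (L2_norm \<Omega> (\<lambda>x. A x + R x))\<^sup>2"
      by (rule order_trans[OF abs_triangle_ineq]) (simp add: abs_mult)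
    also have "\<dots> \<le> ?B r"
      using L2_Cauchy_Schwarz[OF Us R] L2_norm_triangle[OF A R] unfolding R_def[symmetric]
      by (intro add_mono mult_left_mono power_mono) auto
    finally show "\<bar>((L2_norm \<Omega> (U r))\<^sup>2 - (L2_norm \<Omega> (U s))\<^sup>2) / (r - s)
       - 2 * L2_inner \<Omega> (U s) A\<bar> \<le> ?B r" .
  qed
qed simp

lemma has_L2_derivative_imp_continuous:
  assumes der: "has_L2_derivative \<Omega> U A s I"
    and U: "\<And>r. r \<in> I \<Longrightarrow> in_L2 \<Omega> (U r)" and A: "in_L2 \<Omega> A" and s: "s \<in> I"
  shows "((\<lambda>r. L2_norm \<Omega> (\<lambda>x. U r x - U s x)) \<longlongrightarrow> 0) (at s within I)"
proof (rule tendsto_sandwich[OF _ _ tendsto_const])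
  let ?R = "\<lambda>r x. (U r x - U s x) /\<^sub>R (r - s) - A x"
  let ?B = "\<lambda>r. \<bar>r - s\<bar> * (L2_norm \<Omega> (?R r) + L2_norm \<Omega> A)"
  have "(?B \<longlongrightarrow> \<bar>s - s\<bar> * (0 + L2_norm \<Omega> A)) (at s within I)"
    by (intro tendsto_intros der[unfolded has_L2_derivative_def])
  then show "(?B \<longlongrightarrow> 0) (at s within I)" by simp
  show "\<forall>\<^sub>F r in at s within I. L2_norm \<Omega> (\<lambda>x. U r x - U s x) \<le> ?B r"
    unfolding eventually_at_filter
  proof (intro always_eventually allI impI)
    fix r assume "r \<noteq> s" "r \<in> I"
    have R: "in_L2 \<Omega> (?R r)"
      using U \<open>r \<in> I\<close> s A by (auto intro!: in_L2_diff in_L2_scaleR)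
    have "L2_norm \<Omega> (\<lambda>x. U r x - U s x) = L2_norm \<Omega> (\<lambda>x. (r - s) *\<^sub>R (?R r x + A x))"
      using \<open>r \<noteq> s\<close> by simp
    also have "\<dots> \<le> ?B r"
      unfolding L2_norm_scaleR by (intro mult_left_mono L2_norm_triangle R A) auto
    finally show "L2_norm \<Omega> (\<lambda>x. U r x - U s x) \<le> ?B r" .
  qed
qed simp

lemma L2_norm_Pair_le:
  assumes "in_L2 \<Omega> f" "in_L2 \<Omega> g"
  shows "L2_norm \<Omega> (\<lambda>x. (f x, g x)) \<le> L2_norm \<Omega> f + L2_norm \<Omega> g"
  by (rule power2_le_imp_le) (simp_all add: L2_norm_Pair_sq[OF assms] power2_sum)

lemma L2_norm_diff_ineq:
  assumes "in_L2 \<Omega> f" "in_L2 \<Omega> g"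
  shows "\<bar>L2_norm \<Omega> f - L2_norm \<Omega> g\<bar> \<le> L2_norm \<Omega> (\<lambda>x. f x - g x)"
  using L2_norm_triangle[OF in_L2_diff[OF assms] assms(2)]
    L2_norm_triangle[OF in_L2_diff[OF assms(2,1)] assms(1)]
  by (simp add: L2_norm_minus_commute[of \<Omega> g f] abs_le_iff)

lemma L2_continuous_imp_continuous_on_norm:
  assumes lim: "\<And>s. s \<in> I \<Longrightarrow> ((\<lambda>r. L2_norm \<Omega> (\<lambda>x. U r x - U s x)) \<longlongrightarrow> 0) (at s within I)"
    and U: "\<And>s. s \<in> I \<Longrightarrow> in_L2 \<Omega> (U s)" and c: "in_L2 \<Omega> c"
  shows "continuous_on I (\<lambda>s. L2_norm \<Omega> (\<lambda>x. U s x - c x))"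
  unfolding continuous_on_def
proof
  fix s assume s: "s \<in> I"
  show "((\<lambda>r. L2_norm \<Omega> (\<lambda>x. U r x - c x)) \<longlongrightarrow> L2_norm \<Omega> (\<lambda>x. U s x - c x)) (at s within I)"
  proof (rule LIM_zero_cancel, rule Lim_null_comparison[OF _ lim[OF s]])
    show "\<forall>\<^sub>F r in at s within I. norm (L2_norm \<Omega> (\<lambda>x. U r x - c x) - L2_norm \<Omega> (\<lambda>x. U s x - c x))
        \<le> L2_norm \<Omega> (\<lambda>x. U r x - U s x)"
      unfolding eventually_at_filter
    proof (intro always_eventually allI impI)
      fix r assume "r \<in> I"
      then show "norm (L2_norm \<Omega> (\<lambda>x. U r x - c x) - L2_norm \<Omega> (\<lambda>x. U s x - c x))
          \<le> L2_norm \<Omega> (\<lambda>x. U r x - U s x)"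
        using L2_norm_diff_ineq[OF in_L2_diff[OF U c] in_L2_diff[OF U c], of r s] s by simp
    qed
  qed
qed

text \<open>The norm need not be differentiable where U vanishes. Its regularisation sqrt(N^2 + e^2)
  is differentiable everywhere, with derivative bounded by B because N is at most the regularised
  norm; then e is arbitrary.\<close>

lemma L2_norm_Lipschitz:
  assumes der: "\<And>s. s \<in> I \<Longrightarrow> has_L2_derivative \<Omega> U (A s) s I"
    and U: "\<And>s. s \<in> I \<Longrightarrow> in_L2 \<Omega> (U s)" and A: "\<And>s. s \<in> I \<Longrightarrow> in_L2 \<Omega> (A s)"
    and bound: "\<And>s. s \<in> I \<Longrightarrow> \<bar>L2_inner \<Omega> (U s) (A s)\<bar> \<le> B * L2_norm \<Omega> (U s)"
    and "B \<ge> 0" "convex I" and rs: "r \<in> I" "s \<in> I"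
  shows "\<bar>L2_norm \<Omega> (U s) - L2_norm \<Omega> (U r)\<bar> \<le> B * \<bar>s - r\<bar>"
proof (rule field_le_epsilon)
  fix e :: real assume "e > 0"
  define N where "N s = L2_norm \<Omega> (U s)" for s
  define f where "f s = sqrt ((N s)\<^sup>2 + e\<^sup>2)" for s
  have N0: "N s \<ge> 0" for s by (simp add: N_def)
  have f: "f s > 0" "N s \<le> f s" "f s \<le> N s + e" for s
  proof -
    show "f s > 0" using \<open>e > 0\<close> by (simp add: f_def add_nonneg_pos)
    show "N s \<le> f s" unfolding f_def by (rule real_le_rsqrt) simp
    show "f s \<le> N s + e" unfolding f_def
      by (rule real_le_lsqrt) (use N0[of s] \<open>e > 0\<close> in \<open>auto simp: power2_sum\<close>)
  qed
  have "norm (f s - f r) \<le> B * norm (s - r)"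
  proof (rule field_differentiable_bound[OF \<open>convex I\<close> _ _ rs(2,1)])
    fix s assume s: "s \<in> I"
    have pos: "(N s)\<^sup>2 + e\<^sup>2 > 0" using \<open>e > 0\<close> by (simp add: add_nonneg_pos)
    have "((\<lambda>s. (N s)\<^sup>2) has_real_derivative 2 * L2_inner \<Omega> (U s) (A s)) (at s within I)"
      unfolding N_def by (rule L2_norm_sq_has_derivative[OF der U A]) (use s in auto)
    from DERIV_add[OF this DERIV_const]
    have "((\<lambda>s. (N s)\<^sup>2 + e\<^sup>2) has_real_derivative 2 * L2_inner \<Omega> (U s) (A s)) (at s within I)"
      by simp
    from DERIV_chain2[OF DERIV_real_sqrt[OF pos] this]
    show "(f has_field_derivative L2_inner \<Omega> (U s) (A s) / f s) (at s within I)"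
      unfolding f_def by (simp add: field_simps)
    have "\<bar>L2_inner \<Omega> (U s) (A s)\<bar> \<le> B * f s"
      using bound[OF s] mult_left_mono[OF f(2)[of s] \<open>B \<ge> 0\<close>] by (simp add: N_def)
    then show "norm (L2_inner \<Omega> (U s) (A s) / f s) \<le> B"
      using f(1)[of s] by (simp add: divide_le_eq)
  qed
  \<comment> \<open>Since N lies below f by at most e at both times, the difference changes by at
    most e, not 2e.\<close>
  then show "\<bar>L2_norm \<Omega> (U s) - L2_norm \<Omega> (U r)\<bar> \<le> B * \<bar>s - r\<bar> + e"
    using f(2,3)[of s] f(2,3)[of r] unfolding N_def by (simp add: abs_le_iff)
qed


section \<open>Test functions\<close>

text \<open>\<open>flat 1\<close> is the classical function exp(-1/s), extended by 0. The polynomial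
  in 1/s is the prefactor that repeated differentiation creates.\<close>

definition flat :: "real poly \<Rightarrow> real \<Rightarrow> real" where
  "flat p s = (if s > 0 then poly p (1 / s) * exp (- (1 / s)) else 0)"

lemma tendsto_poly_times_exp_minus: "((\<lambda>y::real. poly p y * exp (- y)) \<longlongrightarrow> 0) at_top"
proof -
  have "((\<lambda>y. \<Sum>i\<le>degree p. coeff p i * (y ^ i / exp y)) \<longlongrightarrow> (\<Sum>i\<le>degree p. coeff p i * 0)) at_top"
    by (intro tendsto_intros tendsto_power_div_exp_0)
  then show ?thesis
    by (simp add: poly_altdef exp_minus sum_distrib_right divide_inverse mult.assoc)
qed

text \<open>The functions \<open>flat p\<close> are closed under differentiation, so they are smooth across \<open>0\<close>.\<close>

lemma flat_has_derivative:
  "(flat p has_real_derivative flat ([:0, 0, 1:] * (p - pderiv p)) s) (at s)"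
proof -
  \<comment> \<open>With y = 1/s, both the inner derivative of p and that of the exponential bring a
    factor y^2, with opposite signs.\<close>
  let ?q = "[:0, 0, 1:] * (p - pderiv p)"
  consider "s > 0" | "s < 0" | "s = 0" by linarith
  then show ?thesis
  proof cases
    case 1
    have "((\<lambda>s. poly p (1 / s) * exp (- (1 / s))) has_real_derivative flat ?q s) (at s)"
      using 1 by (auto intro!: derivative_eq_intros DERIV_chain2[OF poly_DERIV]
          simp: flat_def field_simps power2_eq_square)
    then show ?thesis
      by (rule DERIV_cong_ev[THEN iffD1, OF refl _ refl, rotated])
         (use 1 eventually_nhds_in_open[of "{0<..}" s] in
          \<open>auto elim!: eventually_mono simp: flat_def\<close>)
  next
    case 2
    have "((\<lambda>s. 0) has_real_derivative flat ?q s) (at s)"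
      using 2 by (simp add: flat_def)
    then show ?thesis
      by (rule DERIV_cong_ev[THEN iffD1, OF refl _ refl, rotated])
         (use 2 eventually_nhds_in_open[of "{..<0}" s] in
          \<open>auto elim!: eventually_mono simp: flat_def\<close>)
  next
    case 3
    have "((\<lambda>h. flat p h / h) \<longlongrightarrow> 0) (at_right 0)"
    proof (rule Lim_transform_eventually)
      \<comment> \<open>Dividing by h multiplies the polynomial by y = 1/h, which is what
        \<open>pCons 0\<close> does; the exponential still wins as y tends to infinity.\<close>
      show "((\<lambda>h::real. poly (pCons 0 p) (inverse h) * exp (- inverse h)) \<longlongrightarrow> 0) (at_right 0)"
        by (rule filterlim_compose[OF tendsto_poly_times_exp_minus filterlim_inverse_at_top_right])
      show "\<forall>\<^sub>F h in at_right 0. poly (pCons 0 p) (inverse h) * exp (- inverse h) = flat p h / h"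
        by (auto simp: eventually_at_filter flat_def divide_inverse)
    qed
    moreover have "((\<lambda>h. flat p h / h) \<longlongrightarrow> 0) (at_left 0)"
      by (rule Lim_transform_eventually[OF tendsto_const])
         (auto simp: eventually_at_filter flat_def)
    ultimately have "((\<lambda>h. flat p h / h) \<longlongrightarrow> 0) (at 0)"
      by (simp add: filterlim_split_at)
    then show ?thesis using 3
      by (simp add: has_field_derivative_iff flat_def)
  qed
qed

text \<open>A class closed under directional derivatives: smoothness of all its members then follows
  from one induction on the order, with no product rule for \<open>C_on\<close>. Constants are
  included because the chain rule produces the factor \<open>h \<bullet> u\<close>.\<close>

inductive_set bump_algebra :: "('a::euclidean_space \<Rightarrow> real) set" where
  const: "(\<lambda>x. c) \<in> bump_algebra"
| flat: "(\<lambda>x. flat p (x \<bullet> u + c)) \<in> bump_algebra"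
| add: "f \<in> bump_algebra \<Longrightarrow> g \<in> bump_algebra \<Longrightarrow> (\<lambda>x. f x + g x) \<in> bump_algebra"
| mult: "f \<in> bump_algebra \<Longrightarrow> g \<in> bump_algebra \<Longrightarrow> (\<lambda>x. f x * g x) \<in> bump_algebra"

lemma bump_algebra_derivative:
  assumes "f \<in> bump_algebra"
  shows "\<exists>f'. (\<forall>x. (f has_derivative f' x) (at x)) \<and> (\<forall>h. (\<lambda>x. f' x h) \<in> bump_algebra)"
  using assms
proof induction
  case (const c)
  then show ?case
    by (intro exI[of _ "\<lambda>x h. 0"]) (auto intro: bump_algebra.intros)
next
  case (flat p u c)
  let ?q = "[:0, 0, 1:] * (p - pderiv p)"
  have "((\<lambda>x. flat p (x \<bullet> u + c)) has_derivative (\<lambda>h. flat ?q (x \<bullet> u + c) * (h \<bullet> u))) (at x)" for x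
    by (rule has_derivative_compose[of "\<lambda>x. x \<bullet> u + c", OF _ flat_has_derivative[of p, THEN has_field_derivative_imp_has_derivative]])
       (auto intro!: derivative_eq_intros)
  moreover have "(\<lambda>x. flat ?q (x \<bullet> u + c) * (h \<bullet> u)) \<in> bump_algebra" for h
    by (intro bump_algebra.intros)
  ultimately show ?case
    by (intro exI[of _ "\<lambda>x h. flat ?q (x \<bullet> u + c) * (h \<bullet> u)"] conjI allI)
next
  case (add f g)
  then obtain f' g' where "\<And>x. (f has_derivative f' x) (at x)" "\<And>h. (\<lambda>x. f' x h) \<in> bump_algebra"
    "\<And>x. (g has_derivative g' x) (at x)" "\<And>h. (\<lambda>x. g' x h) \<in> bump_algebra" by blast
  then show ?case
    by (intro exI[of _ "\<lambda>x h. f' x h + g' x h"]) (auto intro: bump_algebra.intros derivative_intros)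
next
  case (mult f g)
  then obtain f' g' where "\<And>x. (f has_derivative f' x) (at x)" "\<And>h. (\<lambda>x. f' x h) \<in> bump_algebra"
    "\<And>x. (g has_derivative g' x) (at x)" "\<And>h. (\<lambda>x. g' x h) \<in> bump_algebra" by blast
  note f'g' = this
  have "(\<lambda>x. f x * g' x h + f' x h * g x) \<in> bump_algebra" for h
    by (rule bump_algebra.add[OF bump_algebra.mult bump_algebra.mult]) (fact mult.hyps f'g')+
  then show ?case
    by (intro exI[of _ "\<lambda>x h. f x * g' x h + f' x h * g x"]) (auto intro: f'g' derivative_intros)
qed

lemma bump_algebra_smooth:
  assumes "f \<in> bump_algebra"
  shows "smooth_on UNIV f"
proof -
  have "C_on n UNIV f" if "f \<in> bump_algebra" for n and f :: "'a \<Rightarrow> real"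
    using that
  proof (induction n arbitrary: f)
    case 0
    then show ?case
      using bump_algebra_derivative[OF 0]
      by (auto intro!: continuous_at_imp_continuous_on dest: has_derivative_continuous)
  next
    case (Suc n)
    obtain f' where f': "\<And>x. (f has_derivative f' x) (at x)" "\<And>h. (\<lambda>x. f' x h) \<in> bump_algebra"
      using bump_algebra_derivative[OF Suc.prems] by blast
    then have "frechet_derivative f (at x) = f' x" for x
      by (metis frechet_derivative_at)
    then show ?case using Suc.IH f' by (auto simp: differentiable_def)
  qed
  then show ?thesis using assms by (auto simp: smooth_on_def)
qed

section \<open>Bump functions approximating the indicator of a box\<close>

lemma bump_algebra_prod:
  "(\<And>i. i \<in> I \<Longrightarrow> f i \<in> bump_algebra) \<Longrightarrow> (\<lambda>x. \<Prod>i\<in>I. f i x) \<in> bump_algebra"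
  by (induction I rule: infinite_finite_induct) (auto intro: bump_algebra.intros)

text \<open>Each factor is positive exactly on one side of a face, so the product is positive
  exactly on the open box. The growing scale drives every factor to 1 there, since exp(-1/s) tends
  to 1 for large s; \<open>Suc\<close> keeps the scale positive at k = 0.\<close>

definition box_bump :: "'a::euclidean_space \<Rightarrow> 'a \<Rightarrow> nat \<Rightarrow> 'a \<Rightarrow> real" where
  "box_bump a b k x =
     (\<Prod>i\<in>Basis. flat 1 (real (Suc k) * (x \<bullet> i - a \<bullet> i)) * flat 1 (real (Suc k) * (b \<bullet> i - x \<bullet> i)))"

lemma flat_1_bounds: "0 \<le> flat 1 s" "flat 1 s \<le> 1" and flat_1_eq_0_iff: "flat 1 s = 0 \<longleftrightarrow> s \<le> 0"
  by (auto simp: flat_def)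

lemma box_bump_bounds: "0 \<le> box_bump a b k x" "box_bump a b k x \<le> 1"
  unfolding box_bump_def
  by (auto intro!: prod_nonneg prod_le_1 mult_nonneg_nonneg mult_le_one simp: flat_1_bounds)

lemma box_bump_eq_0_iff: "box_bump a b k x = 0 \<longleftrightarrow> x \<notin> box a b"
  by (auto simp: box_bump_def flat_1_eq_0_iff mem_box mult_le_0_iff not_le not_less)

lemma test_function_box_bump:
  assumes "cbox a b \<subseteq> \<Omega>"
  shows "test_function \<Omega> (box_bump a b k)"
proof -
  have "(\<lambda>x. flat 1 (real (Suc k) * (x \<bullet> i - a \<bullet> i)) * flat 1 (real (Suc k) * (b \<bullet> i - x \<bullet> i))) \<in> bump_algebra"
    for i :: 'a
  proof -
    have "real (Suc k) * (x \<bullet> i - a \<bullet> i) = x \<bullet> (real (Suc k) *\<^sub>R i) + (- real (Suc k) * (a \<bullet> i))"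
      "real (Suc k) * (b \<bullet> i - x \<bullet> i) = x \<bullet> (- real (Suc k) *\<^sub>R i) + real (Suc k) * (b \<bullet> i)" for x
      by (simp_all add: algebra_simps)
    then show ?thesis by (simp only:) (intro bump_algebra.intros)
  qed
  then have "box_bump a b k \<in> bump_algebra"
    unfolding box_bump_def[abs_def] by (rule bump_algebra_prod)
  moreover have "closure {x. box_bump a b k x \<noteq> 0} \<subseteq> cbox a b"
    by (rule closure_minimal) (use box_subset_cbox in \<open>auto simp: box_bump_eq_0_iff\<close>)
  ultimately show ?thesis
    using assms bump_algebra_smooth unfolding test_function_def
    by (auto intro: bounded_subset[OF bounded_cbox] simp: compact_eq_bounded_closed)
qed

lemma box_bump_tendsto: "(\<lambda>k. box_bump a b k x) \<longlonglongrightarrow> indicator (box a b) x"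
proof (cases "x \<in> box a b")
  case True
  have *: "(\<lambda>k. flat 1 (real (Suc k) * s)) \<longlonglongrightarrow> 1" if "s > 0" for s :: real
  proof -
    have "(\<lambda>k. exp (- (inverse (real (Suc k)) * (1 / s)))) \<longlonglongrightarrow> exp (- (0 * (1 / s)))"
      by (intro tendsto_intros LIMSEQ_inverse_real_of_nat)
    then show ?thesis using that by (simp add: flat_def divide_inverse)
  qed
  have "(\<lambda>k. box_bump a b k x) \<longlonglongrightarrow> (\<Prod>i\<in>(Basis::'a set). 1 * 1)"
    unfolding box_bump_def using True by (intro tendsto_intros *) (auto simp: mem_box)
  then show ?thesis using True by simp
next
  case False
  then have "box_bump a b k x = 0" for k by (simp add: box_bump_eq_0_iff)
  then show ?thesis using False by simp
qed

lemma smooth_on_UNIV_D: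
  assumes "smooth_on UNIV \<phi>"
  shows smooth_has_derivative: "(\<phi> has_derivative frechet_derivative \<phi> (at x)) (at x)"
    and smooth_continuous: "continuous_on UNIV \<phi>"
    and smooth_deriv_continuous: "continuous_on UNIV (\<lambda>x. frechet_derivative \<phi> (at x) h)"
proof -
  show "(\<phi> has_derivative frechet_derivative \<phi> (at x)) (at x)"
    using assms C_on.simps(2)[of 0 UNIV \<phi>] by (auto simp: smooth_on_def frechet_derivative_works[symmetric])
  show "continuous_on UNIV \<phi>"
    using assms C_on.simps(1)[of UNIV \<phi>] by (auto simp: smooth_on_def)
  have "C_on (Suc 0) UNIV \<phi>" using assms by (simp add: smooth_on_def)
  then show "continuous_on UNIV (\<lambda>x. frechet_derivative \<phi> (at x) h)" by simp
qed

lemma in_L2_continuous: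
  assumes "continuous_on UNIV f" "bounded \<Omega>" "\<Omega> \<in> sets lebesgue"
  shows "in_L2 \<Omega> f"
proof -
  have cont: "continuous_on UNIV (\<lambda>x. (norm (f x))\<^sup>2)" by (intro continuous_intros assms)
  have m: "g \<in> borel_measurable (lebesgue_on \<Omega>)" if "continuous_on UNIV g" for g :: "'a \<Rightarrow> 'c::euclidean_space"
    using borel_measurable_continuous_onI[OF that]
    by (intro measurable_restrict_space1 measurable_completion) auto
  have "compact ((\<lambda>x. (norm (f x))\<^sup>2) ` closure \<Omega>)"
    using assms(2) by (intro compact_continuous_image continuous_on_subset[OF cont]) auto
  then obtain B where B: "\<And>x. x \<in> closure \<Omega> \<Longrightarrow> (norm (f x))\<^sup>2 \<le> B"
    by (auto dest!: compact_imp_bounded simp: bounded_iff) blast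
  have "finite_measure (lebesgue_on \<Omega>)"
    by (intro finite_measure_lebesgue_on) (use assms(2,3) bounded_set_imp_lmeasurable in auto)
  then have "integrable (lebesgue_on \<Omega>) (\<lambda>x. (norm (f x))\<^sup>2)"
    by (rule finite_measure.integrable_const_bound[where B = B])
       (use B[OF subsetD[OF closure_subset]] m[OF cont] in \<open>auto intro!: AE_I2\<close>)
  then show ?thesis using m[OF assms(1)] by (simp add: in_L2_def)
qed

text \<open>The integrals of the difference quotients vanish by translation invariance.\<close>

lemma integral_directional_derivative_eq_0:
  fixes g :: "'a::euclidean_space \<Rightarrow> real"
  assumes g': "\<And>x. (g has_derivative g' x) (at x)"
    and cont: "continuous_on UNIV (\<lambda>x. g' x u)"
    and comp: "bounded {x. g x \<noteq> 0}" and u: "norm u = 1"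
  shows "(\<integral>x. g' x u \<partial>lborel) = 0"
proof -
  obtain R where R: "\<And>x. g x \<noteq> 0 \<Longrightarrow> norm x \<le> R" using comp by (auto simp: bounded_iff)
  \<comment> \<open>Segments of length at most 1 that start in the ball of radius R + 1 stay in this
    larger ball.\<close>
  have "compact ((\<lambda>x. g' x u) ` cball 0 (R + 2))"
    by (intro compact_continuous_image continuous_on_subset[OF cont]) auto
  then obtain B where B: "\<And>x. norm x \<le> R + 2 \<Longrightarrow> \<bar>g' x u\<bar> \<le> B"
    by (fastforce dest!: compact_imp_bounded simp: bounded_iff)
  define h :: "nat \<Rightarrow> real" where "h n = inverse (real (Suc n))" for n
  have h: "0 < h n" "h n \<le> 1" for n by (auto simp: h_def field_simps)
  have h0: "h \<longlonglongrightarrow> 0" unfolding h_def by (rule LIMSEQ_inverse_real_of_nat)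
  define q where "q n x = (g (x + h n *\<^sub>R u) - g x) / h n" for n x
  have line: "((\<lambda>t. g (x + t *\<^sub>R u)) has_real_derivative g' (x + t *\<^sub>R u) u) (at t within S)" for x t S
  proof -
    have "((\<lambda>t. x + t *\<^sub>R u) has_derivative (\<lambda>t. t *\<^sub>R u)) (at t within S)"
      by (auto intro!: derivative_eq_intros)
    from has_derivative_compose[OF this g']
    show ?thesis
      unfolding has_field_derivative_def
      by (simp add: linear_scale[OF has_derivative_linear[OF g']] mult.commute[of _ "g' _ _"])
  qed
  have contg: "continuous_on S g" for S
    by (intro continuous_at_imp_continuous_on ballI has_derivative_continuous[OF g'])
  have int_g: "integrable lborel g"
  proof -
    have "integrable lborel (\<lambda>x. indicator (cball 0 R) x *\<^sub>R g x)"
      by (rule borel_integrable_compact[OF compact_cball contg])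
    also have "(\<lambda>x. indicator (cball 0 R) x *\<^sub>R g x) = g"
      using R by (auto simp: indicator_def fun_eq_iff)
    finally show ?thesis .
  qed
  have [measurable]: "g \<in> borel_measurable borel" "(\<lambda>x. g' x u) \<in> borel_measurable borel"
    using contg cont by (auto intro: borel_measurable_continuous_onI)
  have shift: "integrable lborel (\<lambda>x. g (x + c))" "(\<integral>x. g (x + c) \<partial>lborel) = (\<integral>x. g x \<partial>lborel)" for c
  proof -
    have "integrable (distr lborel borel ((+) c)) g" using int_g by (simp add: lborel_distr_plus)
    then show "integrable lborel (\<lambda>x. g (x + c))"
      by (subst (asm) integrable_distr_eq) (simp_all add: add.commute)
    have "(\<integral>x. g x \<partial>lborel) = (\<integral>x. g x \<partial>distr lborel borel ((+) c))" by (simp add: lborel_distr_plus)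
    also have "\<dots> = (\<integral>x. g (x + c) \<partial>lborel)" by (subst integral_distr) (simp_all add: add.commute)
    finally show "(\<integral>x. g (x + c) \<partial>lborel) = (\<integral>x. g x \<partial>lborel)" ..
  qed
  have q0: "(\<integral>x. q n x \<partial>lborel) = 0" for n
    unfolding q_def using shift int_g by simp
  have "(\<lambda>n. \<integral>x. q n x \<partial>lborel) \<longlonglongrightarrow> (\<integral>x. g' x u \<partial>lborel)"
  proof (rule integral_dominated_convergence)
    \<comment> \<open>Domination: beyond radius R + 1 both x and its translate lie outside the
      support, so the quotient is 0; inside, the mean value inequality bounds it by B.\<close>
    show "integrable lborel (\<lambda>x. indicator (cball 0 (R + 1)) x *\<^sub>R B)"
      by (rule borel_integrable_compact) auto
    show "AE x in lborel. (\<lambda>n. q n x) \<longlonglongrightarrow> g' x u"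
    proof (rule AE_I2)
      fix x
      have "((\<lambda>t. (g (x + t *\<^sub>R u) - g x) / t) \<longlongrightarrow> g' x u) (at 0)"
        using line[of x 0 UNIV] by (simp add: DERIV_def)
      then show "(\<lambda>n. q n x) \<longlonglongrightarrow> g' x u"
        unfolding q_def
      proof (rule filterlim_compose)
        have "h n \<noteq> 0" for n using h(1)[of n] by simp
        then show "filterlim h (at 0) sequentially" using h0 by (simp add: filterlim_at)
      qed
    qed
    show "AE x in lborel. norm (q n x) \<le> indicator (cball 0 (R + 1)) x *\<^sub>R B" for n
    proof (rule AE_I2)
      fix x
      show "norm (q n x) \<le> indicator (cball 0 (R + 1)) x *\<^sub>R B"
      proof (cases "norm x \<le> R + 1")
        case True
        have "norm (g (x + h n *\<^sub>R u) - g (x + 0 *\<^sub>R u)) \<le> B * norm (h n - 0)"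
        proof (rule field_differentiable_bound[OF _ line])
          show "norm (g' (x + t *\<^sub>R u) u) \<le> B" if "t \<in> {0..h n}" for t
            using that h[of n] True norm_triangle_ineq[of x "t *\<^sub>R u"] u by (auto intro!: B)
        qed (use h[of n] in auto)
        then show ?thesis using True h[of n] by (simp add: q_def field_simps)
      next
        case False
        then have "\<not> norm (x + h n *\<^sub>R u) \<le> R"
          using norm_triangle_ineq4[of "x + h n *\<^sub>R u" "h n *\<^sub>R u"] h[of n] u by auto
        then have "g (x + h n *\<^sub>R u) = 0" "g x = 0"
          using R[of "x + h n *\<^sub>R u"] R[of x] False by auto
        then show ?thesis using False by (simp add: q_def)
      qed
    qed
  qed (auto simp: q_def)
  then show ?thesis by (simp add: q0 LIMSEQ_const_iff)
qed


section \<open>Weak gradients and Green's formula\<close>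

definition classical_grad :: "('a::euclidean_space \<Rightarrow> real) \<Rightarrow> 'a \<Rightarrow> 'a" where
  "classical_grad \<phi> x = (\<Sum>i\<in>Basis. frechet_derivative \<phi> (at x) i *\<^sub>R i)"

lemma classical_grad_inner: "i \<in> Basis \<Longrightarrow> classical_grad \<phi> x \<bullet> i = frechet_derivative \<phi> (at x) i"
  by (simp add: classical_grad_def inner_sum_left inner_Basis if_distrib cong: if_cong)

locale bounded_open =
  fixes \<Omega> :: "'a::euclidean_space set"
  assumes open_dom: "open \<Omega>" and bounded_dom: "bounded \<Omega>"
begin

lemma sets_dom [measurable, simp]: "\<Omega> \<in> sets lebesgue"
  using open_dom by auto

lemma in_L2_continuous_dom: "continuous_on UNIV f \<Longrightarrow> in_L2 \<Omega> f"
  by (rule in_L2_continuous) (simp_all add: bounded_dom)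

lemma in_L2_test:
  assumes "test_function \<Omega> \<phi>"
  shows "in_L2 \<Omega> \<phi>" "in_L2 \<Omega> (\<lambda>x. frechet_derivative \<phi> (at x) h)" "in_L2 \<Omega> (classical_grad \<phi>)"
  using assms smooth_continuous smooth_deriv_continuous unfolding classical_grad_def[abs_def]
  by (auto simp: test_function_def intro!: in_L2_continuous_dom continuous_intros)

lemma test_function_zero_outside:
  assumes "test_function \<Omega> \<phi>" "x \<notin> \<Omega>"
  shows "\<phi> x = 0"
  using assms closure_subset[of "{x. \<phi> x \<noteq> 0}"] by (auto simp: test_function_def)

lemma has_weak_gradient_iff:
  "has_weak_gradient \<Omega> f G \<longleftrightarrow> in_L2 \<Omega> f \<and> in_L2 \<Omega> G \<and>
     (\<forall>\<phi>. test_function \<Omega> \<phi> \<longrightarrow> (\<forall>i\<in>Basis.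
        L2_inner \<Omega> f (\<lambda>x. frechet_derivative \<phi> (at x) i) = - L2_inner \<Omega> (\<lambda>x. G x \<bullet> i) \<phi>))"
  by (simp add: has_weak_gradient_def L2_inner_def)

text \<open>Integration by parts: the product of \<phi> and the test function \<psi> has bounded
  support, so the integral of its directional derivative vanishes, and the product rule splits that
  derivative.\<close>

lemma test_function_has_weak_gradient:
  assumes \<phi>: "test_function \<Omega> \<phi>"
  shows "has_weak_gradient \<Omega> \<phi> (classical_grad \<phi>)"
  unfolding has_weak_gradient_iff
proof (intro conjI allI impI ballI in_L2_test \<phi>)
  fix \<psi> :: "'a \<Rightarrow> real" and i :: 'a assume \<psi>: "test_function \<Omega> \<psi>" and i: "i \<in> Basis"
  let ?D = "\<lambda>\<phi> x. frechet_derivative \<phi> (at x)"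
  let ?g' = "\<lambda>x h. \<phi> x * ?D \<psi> x h + ?D \<phi> x h * \<psi> x"
  have sm: "smooth_on UNIV \<phi>" "smooth_on UNIV \<psi>" using \<phi> \<psi> by (auto simp: test_function_def)
  have cont: "continuous_on UNIV (\<lambda>x. ?g' x i)"
    by (intro continuous_intros smooth_continuous smooth_deriv_continuous sm)
  have "bounded {x. \<phi> x * \<psi> x \<noteq> 0}"
    by (rule bounded_subset[OF bounded_dom]) (use test_function_zero_outside[OF \<phi>] in auto)
  then have "(\<integral>x. ?g' x i \<partial>lborel) = 0"
    by (intro integral_directional_derivative_eq_0[where g = "\<lambda>x. \<phi> x * \<psi> x" and g' = ?g'] cont
        has_derivative_mult smooth_has_derivative sm norm_Basis i)
  \<comment> \<open>Each term of the product rule keeps one undifferentiated factor, which vanishes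
    outside \<Omega>.\<close>
  moreover have "(\<integral>x. ?g' x i \<partial>lebesgue_on \<Omega>) = (\<integral>x. ?g' x i \<partial>lborel)"
  proof -
    have "(\<integral>x. ?g' x i \<partial>lebesgue_on \<Omega>) = (\<integral>x. indicator \<Omega> x *\<^sub>R ?g' x i \<partial>lebesgue)"
      by (rule integral_restrict_space) simp
    also have "(\<lambda>x. indicator \<Omega> x *\<^sub>R ?g' x i) = (\<lambda>x. ?g' x i)"
      using test_function_zero_outside[OF \<phi>] test_function_zero_outside[OF \<psi>]
      by (auto simp: indicator_def fun_eq_iff)
    also have "(\<integral>x. ?g' x i \<partial>lebesgue) = (\<integral>x. ?g' x i \<partial>lborel)"
      by (rule integral_completion) (use borel_measurable_continuous_onI[OF cont] in simp)
    finally show ?thesis .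
  qed
  ultimately have "L2_inner \<Omega> \<phi> (\<lambda>x. ?D \<psi> x i) + L2_inner \<Omega> (\<lambda>x. ?D \<phi> x i) \<psi> = 0"
    using integrable_inner_L2[OF in_L2_test(1)[OF \<phi>] in_L2_test(2)[OF \<psi>]]
      integrable_inner_L2[OF in_L2_test(2)[OF \<phi>] in_L2_test(1)[OF \<psi>]]
    by (simp add: L2_inner_def)
  then show "L2_inner \<Omega> \<phi> (\<lambda>x. ?D \<psi> x i) = - L2_inner \<Omega> (\<lambda>x. classical_grad \<phi> x \<bullet> i) \<psi>"
    using i by (simp add: classical_grad_inner)
qed

text \<open>Testing against bumps that converge to the indicator of a box shows that the integrals over all
  boxes in \<open>\<Omega>\<close> vanish; Lebesgue differentiation then gives the claim.\<close>

lemma weakly_zero_imp_AE_zero: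
  assumes g: "in_L2 \<Omega> (g :: 'a \<Rightarrow> real)"
    and zero: "\<And>\<phi>. test_function \<Omega> \<phi> \<Longrightarrow> L2_inner \<Omega> g \<phi> = 0"
  shows "AE x in lebesgue_on \<Omega>. g x = 0"
proof -
  note [measurable] = in_L2_measurable[OF g]
  have int_g: "integrable (lebesgue_on \<Omega>) g"
    using integrable_inner_L2[OF g in_L2_continuous_dom[of "\<lambda>x. 1"]] by simp
  define F where "F x = indicator \<Omega> x *\<^sub>R g x" for x
  have "integrable lebesgue F"
    using int_g unfolding F_def by (subst (asm) integrable_restrict_space) auto
  then have F: "set_integrable lebesgue S F" if "S \<in> sets lebesgue" for S
    using set_integrable_subset[of lebesgue UNIV F S] that by (simp add: set_integrable_def)
  have box0: "integral (cbox a b) F = 0" if ab: "cbox a b \<subseteq> \<Omega>" for a b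
  proof -
    have m: "h \<in> borel_measurable (lebesgue_on \<Omega>)" if "h \<in> borel_measurable borel" for h :: "'a \<Rightarrow> real"
      using that by (intro measurable_restrict_space1 measurable_completion) auto
    have [measurable]: "box_bump a b k \<in> borel_measurable (lebesgue_on \<Omega>)" for k
      using smooth_continuous test_function_box_bump[OF ab]
      by (intro m borel_measurable_continuous_onI) (auto simp: test_function_def)
    have [measurable]: "indicat_real (box a b) \<in> borel_measurable (lebesgue_on \<Omega>)"
      by (intro m) auto
    \<comment> \<open>The bumps lie between 0 and 1, so |g| dominates; g is integrable since the
      bounded domain makes the constant 1 square-integrable.\<close>
    have "(\<lambda>k. L2_inner \<Omega> g (box_bump a b k)) \<longlonglongrightarrow> (\<integral>x. g x \<bullet> indicator (box a b) x \<partial>lebesgue_on \<Omega>)"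
      unfolding L2_inner_def
    proof (rule integral_dominated_convergence[where w = "\<lambda>x. \<bar>g x\<bar>"])
      show "AE x in lebesgue_on \<Omega>. (\<lambda>k. g x \<bullet> box_bump a b k x) \<longlonglongrightarrow> g x \<bullet> indicator (box a b) x"
        by (intro AE_I2 tendsto_intros box_bump_tendsto)
      show "AE x in lebesgue_on \<Omega>. norm (g x \<bullet> box_bump a b k x) \<le> \<bar>g x\<bar>" for k
        by (intro AE_I2) (use box_bump_bounds[of a b k] in \<open>simp add: abs_mult mult_left_le\<close>)
    qed (use int_g in auto)
    then have "(\<integral>x. g x \<bullet> indicator (box a b) x \<partial>lebesgue_on \<Omega>) = 0"
      using zero[OF test_function_box_bump[OF ab]] LIMSEQ_unique[OF tendsto_const] by fastforce
    also have "(\<integral>x. g x \<bullet> indicator (box a b) x \<partial>lebesgue_on \<Omega>) = (LINT x:box a b|lebesgue. F x)"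
      unfolding set_lebesgue_integral_def F_def
      by (subst integral_restrict_space) (auto simp: mult_ac)
    also have "\<dots> = integral (box a b) F"
      by (rule set_lebesgue_integral_eq_integral(2)) (auto intro: F)
    also have "\<dots> = integral (cbox a b) F" by (rule integral_open_interval)
    finally show ?thesis .
  qed
  have "F integrable_on cbox a b" for a b
    by (rule set_lebesgue_integral_eq_integral(1)) (auto intro: F)
  \<comment> \<open>Outside a null set, the averages of F over cubes with corner x converge to F(x).
    Taking |F(x)| itself as the tolerance contradicts averages that are 0.\<close>
  then obtain N where N: "negligible N"
    and lim: "\<And>x e. x \<notin> N \<Longrightarrow> 0 < e \<Longrightarrow> \<exists>d>0. \<forall>h. 0 < h \<and> h < d \<longrightarrow>
        norm (integral (cbox x (x + h *\<^sub>R One)) F /\<^sub>R h ^ DIM('a) - F x) < e"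
    using integrable_ccontinuous_explicit[of F] by metis
  have "g x = 0" if "x \<in> \<Omega>" "x \<notin> N" for x
  proof (rule ccontr)
    assume "g x \<noteq> 0"
    then have "norm (F x) > 0" using that by (simp add: F_def)
    from lim[OF \<open>x \<notin> N\<close> this] obtain d where "d > 0" and d: "\<And>h. 0 < h \<Longrightarrow> h < d \<Longrightarrow>
        norm (integral (cbox x (x + h *\<^sub>R One)) F /\<^sub>R h ^ DIM('a) - F x) < norm (F x)" by blast
    obtain e where "e > 0" and e: "cball x e \<subseteq> \<Omega>"
      using open_dom \<open>x \<in> \<Omega>\<close> open_contains_cball by blast
    \<comment> \<open>A bound for the diameter of the unit cube, so a cube of side at most e / c
      with corner x fits into the ball of radius e; the added 1 makes it visibly positive.\<close>
    define c where "c = norm (One :: 'a) + 1"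
    have "c > 0" by (simp add: c_def add_nonneg_pos)
    define h where "h = min (d / 2) (e / c)"
    have h: "0 < h" "h < d" using \<open>d > 0\<close> \<open>e > 0\<close> \<open>c > 0\<close> by (auto simp: h_def)
    have "cbox x (x + h *\<^sub>R One) \<subseteq> cball x e"
    proof
      fix y assume y: "y \<in> cbox x (x + h *\<^sub>R One)"
      have "norm (y - x) \<le> norm (h *\<^sub>R (One :: 'a))"
        using y by (intro norm_le_componentwise) (auto simp: mem_box inner_add_left inner_diff_left)
      also have "\<dots> \<le> h * c" using h by (simp add: c_def)
      also have "\<dots> \<le> e" using \<open>c > 0\<close> by (simp add: h_def min_def field_simps)
      finally show "y \<in> cball x e" by (simp add: dist_norm norm_minus_commute)
    qed
    then have "integral (cbox x (x + h *\<^sub>R One)) F = 0" using e by (intro box0) blast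
    then show False using d[OF h] by simp
  qed
  moreover have "AE x in lebesgue. x \<notin> N"
    using N by (intro AE_not_in) (simp add: negligible_iff_null_sets)
  ultimately show ?thesis by (subst AE_restrict_space_iff) auto
qed

section \<open>Uniqueness and linearity of weak gradients, and independence of the chosen
  representative\<close>

lemma weak_gradient_unique:
  assumes "has_weak_gradient \<Omega> f G" "has_weak_gradient \<Omega> f H"
  shows "AE x in lebesgue_on \<Omega>. G x = H x"
proof -
  have G: "in_L2 \<Omega> G" and H: "in_L2 \<Omega> H" using assms by (auto simp: has_weak_gradient_iff)
  have "AE x in lebesgue_on \<Omega>. \<forall>i\<in>Basis. G x \<bullet> i - H x \<bullet> i = 0"
  proof (rule AE_finite_allI)
    fix i :: 'a assume i: "i \<in> Basis"
    show "AE x in lebesgue_on \<Omega>. G x \<bullet> i - H x \<bullet> i = 0"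
    proof (rule weakly_zero_imp_AE_zero)
      fix \<phi> assume \<phi>: "test_function \<Omega> \<phi>"
      have "L2_inner \<Omega> (\<lambda>x. G x \<bullet> i) \<phi> = L2_inner \<Omega> (\<lambda>x. H x \<bullet> i) \<phi>"
        using assms \<phi> i unfolding has_weak_gradient_iff by (metis neg_equal_iff_equal)
      then show "L2_inner \<Omega> (\<lambda>x. G x \<bullet> i - H x \<bullet> i) \<phi> = 0"
        using L2_inner_diff_left[OF in_L2_inner_const[OF G] in_L2_inner_const[OF H] in_L2_test(1)[OF \<phi>]]
        by simp
    qed (intro in_L2_diff in_L2_inner_const G H)
  qed simp
  then show ?thesis
    by eventually_elim (simp add: euclidean_eq_iff[of "G _"])
qed

text \<open>Two scalars cover plain differences, and two nested instances cover the remainder of a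
  difference quotient.\<close>

lemma has_weak_gradient_lincomb:
  assumes "has_weak_gradient \<Omega> f F" "has_weak_gradient \<Omega> g G"
  shows "has_weak_gradient \<Omega> (\<lambda>x. c *\<^sub>R f x - d *\<^sub>R g x) (\<lambda>x. c *\<^sub>R F x - d *\<^sub>R G x)"
  unfolding has_weak_gradient_iff
proof (intro conjI allI impI ballI)
  have L2: "in_L2 \<Omega> f" "in_L2 \<Omega> F" "in_L2 \<Omega> g" "in_L2 \<Omega> G"
    using assms by (auto simp: has_weak_gradient_iff)
  then show "in_L2 \<Omega> (\<lambda>x. c *\<^sub>R f x - d *\<^sub>R g x)" "in_L2 \<Omega> (\<lambda>x. c *\<^sub>R F x - d *\<^sub>R G x)" 
    by (intro in_L2_diff in_L2_scaleR; simp)+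
  fix \<phi> :: "'a \<Rightarrow> real" and i :: 'a assume \<phi>: "test_function \<Omega> \<phi>" and i: "i \<in> Basis"
  have "L2_inner \<Omega> (\<lambda>x. c *\<^sub>R f x - d *\<^sub>R g x) (\<lambda>x. frechet_derivative \<phi> (at x) i)
     = c * L2_inner \<Omega> f (\<lambda>x. frechet_derivative \<phi> (at x) i)
       - d * L2_inner \<Omega> g (\<lambda>x. frechet_derivative \<phi> (at x) i)"
    using L2_inner_diff_left[OF in_L2_scaleR[OF L2(1)] in_L2_scaleR[OF L2(3)] in_L2_test(2)[OF \<phi>]]
    by (simp only: L2_inner_scaleR_left)
  moreover have "L2_inner \<Omega> (\<lambda>x. c *\<^sub>R (F x \<bullet> i) - d *\<^sub>R (G x \<bullet> i)) \<phi>
     = c * L2_inner \<Omega> (\<lambda>x. F x \<bullet> i) \<phi> - d * L2_inner \<Omega> (\<lambda>x. G x \<bullet> i) \<phi>"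
    using L2_inner_diff_left[OF in_L2_scaleR[OF in_L2_inner_const[OF L2(2)]]
        in_L2_scaleR[OF in_L2_inner_const[OF L2(4)]] in_L2_test(1)[OF \<phi>]]
    by (simp only: L2_inner_scaleR_left)
  ultimately show "L2_inner \<Omega> (\<lambda>x. c *\<^sub>R f x - d *\<^sub>R g x) (\<lambda>x. frechet_derivative \<phi> (at x) i)
      = - L2_inner \<Omega> (\<lambda>x. (c *\<^sub>R F x - d *\<^sub>R G x) \<bullet> i) \<phi>"
    using assms \<phi> i by (simp add: has_weak_gradient_iff inner_diff_left)
qed

lemma in_H1_has_weak_gradient: "in_H1 \<Omega> f \<Longrightarrow> has_weak_gradient \<Omega> f (grad \<Omega> f)"
  unfolding in_H1_def grad_def by (rule someI_ex[of "has_weak_gradient \<Omega> f"])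

lemma in_H1_L2:
  assumes "in_H1 \<Omega> f"
  shows "in_L2 \<Omega> f" "in_L2 \<Omega> (grad \<Omega> f)"
  using in_H1_has_weak_gradient[OF assms] by (auto simp: has_weak_gradient_iff)

lemma grad_AE_eq:
  assumes "has_weak_gradient \<Omega> f G"
  shows "AE x in lebesgue_on \<Omega>. grad \<Omega> f x = G x"
  using assms in_H1_has_weak_gradient[of f] weak_gradient_unique unfolding in_H1_def by blast

text \<open>The choice operator in \<open>grad\<close> acts on each function separately, so
  \<open>grad\<close> is linear only almost everywhere. This transfers norms to any gradient known
  explicitly.\<close>

lemma L2_norm_grad_eq:
  assumes "has_weak_gradient \<Omega> f G"
  shows "L2_norm \<Omega> (grad \<Omega> f) = L2_norm \<Omega> G"
  using assms in_H1_L2[of f] grad_AE_eq[OF assms]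
  by (intro L2_norm_cong_AE) (auto simp: has_weak_gradient_iff in_H1_def)

text \<open>Being a weak gradient depends on the function only through integrals, so functions that
  agree almost everywhere share their weak gradients, although \<open>grad\<close> may pick
  different representatives.\<close>

lemma grad_cong_AE:
  assumes "in_H1 \<Omega> f" "in_H1 \<Omega> g" "ae_eq \<Omega> f g"
  shows "AE x in lebesgue_on \<Omega>. grad \<Omega> f x = grad \<Omega> g x"
proof (rule grad_AE_eq)
  have "L2_inner \<Omega> f h = L2_inner \<Omega> g h" if "in_L2 \<Omega> h" for h
    using assms that in_H1_L2 unfolding ae_eq_def by (intro L2_inner_cong_AE) auto
  then show "has_weak_gradient \<Omega> f (grad \<Omega> g)"
    using in_H1_L2[OF assms(1)] in_H1_has_weak_gradient[OF assms(2)] in_L2_test(2)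
    by (auto simp: has_weak_gradient_iff)
qed

lemma L2_norm_le_H1_norm: "L2_norm \<Omega> f \<le> H1_norm \<Omega> f" "L2_norm \<Omega> (grad \<Omega> f) \<le> H1_norm \<Omega> f"
  by (auto simp: H1_norm_def intro!: real_le_rsqrt)

lemma in_L2_laplacian: "in_H2 \<Omega> f \<Longrightarrow> in_L2 \<Omega> (laplacian \<Omega> f)"
  unfolding laplacian_def partial_def[of \<Omega> _ "partial _ _ _"] in_H2_def
  by (intro in_L2_sum in_L2_inner_const in_H1_L2) auto

text \<open>The Laplacian is a sum of weak derivatives of the \<open>partial \<Omega> i f\<close>;
  moving each of these onto \<phi> by the definition of the weak gradient leaves the inner product
  of the gradients.\<close>

lemma Green_test_function:
  assumes f: "in_H2 \<Omega> f" and \<phi>: "test_function \<Omega> \<phi>"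
  shows "L2_inner \<Omega> (laplacian \<Omega> f) \<phi> = - L2_inner \<Omega> (grad \<Omega> f) (classical_grad \<phi>)"
proof -
  let ?D = "\<lambda>i x. frechet_derivative \<phi> (at x) i"
  have f1: "in_H1 \<Omega> f" and f2: "\<And>i. i \<in> Basis \<Longrightarrow> in_H1 \<Omega> (partial \<Omega> i f)"
    using f by (auto simp: in_H2_def)
  have "L2_inner \<Omega> (laplacian \<Omega> f) \<phi>
      = (\<Sum>i\<in>Basis. L2_inner \<Omega> (\<lambda>x. grad \<Omega> (partial \<Omega> i f) x \<bullet> i) \<phi>)"
    unfolding L2_inner_def laplacian_def partial_def[of \<Omega> _ "partial _ _ _"] inner_sum_left
    by (intro Bochner_Integration.integral_sum integrable_inner_L2 in_L2_inner_const in_H1_L2 f2 in_L2_test \<phi>)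
  also have "\<dots> = (\<Sum>i\<in>Basis. - L2_inner \<Omega> (partial \<Omega> i f) (?D i))"
    using in_H1_has_weak_gradient[OF f2] \<phi> by (intro sum.cong) (auto simp: has_weak_gradient_iff)
  also have "\<dots> = - (\<Sum>i\<in>Basis. \<integral>x. (grad \<Omega> f x \<bullet> i) * (classical_grad \<phi> x \<bullet> i) \<partial>lebesgue_on \<Omega>)"
    by (simp add: L2_inner_def sum_negf partial_def classical_grad_inner)
  also have "(\<Sum>i\<in>Basis. \<integral>x. (grad \<Omega> f x \<bullet> i) * (classical_grad \<phi> x \<bullet> i) \<partial>lebesgue_on \<Omega>)
      = L2_inner \<Omega> (grad \<Omega> f) (classical_grad \<phi>)"
    unfolding L2_inner_def euclidean_inner[of "grad \<Omega> f x" "classical_grad \<phi> x" for x]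
  proof (rule Bochner_Integration.integral_sum[symmetric])
    fix i :: 'a
    show "integrable (lebesgue_on \<Omega>) (\<lambda>x. (grad \<Omega> f x \<bullet> i) * (classical_grad \<phi> x \<bullet> i))"
      using integrable_inner_L2[OF in_L2_inner_const[OF in_H1_L2(2)[OF f1]]
          in_L2_inner_const[OF in_L2_test(3)[OF \<phi>]]] by simp
  qed
  finally show ?thesis .
qed

text \<open>The defect is zero for test functions and is controlled by a constant times the H1
  distance, so it vanishes on their H1 limits.\<close>

lemma Green_H2_H10:
  assumes f: "in_H2 \<Omega> f" and g: "in_H10 \<Omega> g"
  shows "L2_inner \<Omega> (laplacian \<Omega> f) g + L2_inner \<Omega> (grad \<Omega> f) (grad \<Omega> g) = 0" (is "?I = 0")
proof -
  obtain \<phi> where \<phi>: "\<And>n. test_function \<Omega> (\<phi> n)"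
    and lim: "(\<lambda>n. H1_norm \<Omega> (\<lambda>x. \<phi> n x - g x)) \<longlonglongrightarrow> 0"
    using g by (auto simp: in_H10_def)
  have g1: "in_H1 \<Omega> g" and f1: "in_H1 \<Omega> f" using f g by (auto simp: in_H10_def in_H2_def)
  note L2 = in_L2_laplacian[OF f] in_H1_L2(2)[OF f1] in_H1_L2[OF g1] in_L2_test(1,3)[OF \<phi>]
  let ?C = "L2_norm \<Omega> (laplacian \<Omega> f) + L2_norm \<Omega> (grad \<Omega> f)"
  let ?h = "\<lambda>n. H1_norm \<Omega> (\<lambda>x. \<phi> n x - g x)"
  have bound: "\<bar>?I\<bar> \<le> ?C * ?h n" for n
  proof -
    \<comment> \<open>\<open>H1_norm\<close> involves \<open>grad\<close> of the difference;
      \<open>wg\<close> allows it to be replaced by the difference of gradients.\<close>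
    have wg: "has_weak_gradient \<Omega> (\<lambda>x. \<phi> n x - g x) (\<lambda>x. classical_grad (\<phi> n) x - grad \<Omega> g x)"
      using has_weak_gradient_lincomb[OF test_function_has_weak_gradient[OF \<phi>[of n]]
          in_H1_has_weak_gradient[OF g1], of 1 1] by simp
    have "?I = - (L2_inner \<Omega> (laplacian \<Omega> f) (\<lambda>x. \<phi> n x - g x)
       + L2_inner \<Omega> (grad \<Omega> f) (\<lambda>x. classical_grad (\<phi> n) x - grad \<Omega> g x))"
      using Green_test_function[OF f \<phi>[of n]]
      by (simp add: L2_inner_diff_right[OF L2(5,3,1)] L2_inner_diff_right[OF L2(6,4,2)])
    then have "\<bar>?I\<bar> \<le> \<bar>L2_inner \<Omega> (laplacian \<Omega> f) (\<lambda>x. \<phi> n x - g x)\<bar>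
       + \<bar>L2_inner \<Omega> (grad \<Omega> f) (\<lambda>x. classical_grad (\<phi> n) x - grad \<Omega> g x)\<bar>"
      by (simp only: abs_minus_cancel abs_triangle_ineq)
    also have "\<dots> \<le> L2_norm \<Omega> (laplacian \<Omega> f) * L2_norm \<Omega> (\<lambda>x. \<phi> n x - g x)
       + L2_norm \<Omega> (grad \<Omega> f) * L2_norm \<Omega> (\<lambda>x. classical_grad (\<phi> n) x - grad \<Omega> g x)"
      by (intro add_mono L2_Cauchy_Schwarz L2 in_L2_diff)
    also have "\<dots> \<le> L2_norm \<Omega> (laplacian \<Omega> f) * ?h n + L2_norm \<Omega> (grad \<Omega> f) * ?h n"
      unfolding L2_norm_grad_eq[OF wg, symmetric]
      by (intro add_mono mult_left_mono L2_norm_le_H1_norm) auto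
    finally show ?thesis by (simp add: distrib_right)
  qed
  have "(\<lambda>n. ?C * ?h n) \<longlonglongrightarrow> ?C * 0" by (intro tendsto_intros lim)
  then have "\<bar>?I\<bar> \<le> ?C * 0" by (rule LIMSEQ_le_const) (use bound in auto)
  then show ?thesis by simp
qed

end


section \<open>Energy estimates\<close>

definition wave_state :: "'a::euclidean_space set \<Rightarrow> ('a \<Rightarrow> real) \<Rightarrow> ('a \<Rightarrow> real) \<Rightarrow> 'a \<Rightarrow> real \<times> 'a" where
  "wave_state \<Omega> z v = (\<lambda>x. (v x, grad \<Omega> z x))"

text \<open>The source is a parameter fixed in time and detached from the sampling, so that pieces
  with different held inputs can be compared on a common interval.\<close>

definition wave_on ::
    "'a::euclidean_space set \<Rightarrow> real set \<Rightarrow> ('a \<Rightarrow> real) \<Rightarrow> (real \<Rightarrow> 'a \<Rightarrow> real) \<Rightarrow> (real \<Rightarrow> 'a \<Rightarrow> real) \<Rightarrow> bool" where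
  "wave_on \<Omega> I f z v \<longleftrightarrow> strong_regularity \<Omega> I z v \<and> in_L2 \<Omega> f \<and>
     (\<forall>s\<in>I. \<exists>a. in_L2 \<Omega> a \<and> has_time_derivative (L2_norm \<Omega>) v a s I \<and>
        (AE x in lebesgue_on \<Omega>. a x = laplacian \<Omega> (z s) x + f x))"

context bounded_open begin

lemma strong_regularity_D:
  assumes "strong_regularity \<Omega> I z v" "s \<in> I"
  shows "in_H2 \<Omega> (z s)" "in_H10 \<Omega> (z s)" "in_H10 \<Omega> (v s)" "in_H1 \<Omega> (z s)" "in_H1 \<Omega> (v s)"
  using assms by (auto simp: strong_regularity_def in_H2_def in_H10_def)

lemma in_L2_wave_state: "in_H1 \<Omega> z \<Longrightarrow> in_L2 \<Omega> v \<Longrightarrow> in_L2 \<Omega> (wave_state \<Omega> z v)"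
  unfolding wave_state_def by (intro in_L2_Pair in_H1_L2(2))

lemma L2_inner_wave_state:
  assumes "in_H1 \<Omega> z" "in_H1 \<Omega> w" "in_L2 \<Omega> v" "in_L2 \<Omega> a"
  shows "L2_inner \<Omega> (wave_state \<Omega> z v) (wave_state \<Omega> w a)
      = L2_inner \<Omega> v a + L2_inner \<Omega> (grad \<Omega> z) (grad \<Omega> w)"
  using integrable_inner_L2[OF assms(3,4)] integrable_inner_L2[OF in_H1_L2(2)[OF assms(1)] in_H1_L2(2)[OF assms(2)]]
  by (simp add: L2_inner_def wave_state_def)

lemma energy_wave_state:
  assumes "in_H1 \<Omega> z" "in_L2 \<Omega> v"
  shows "2 * energy \<Omega> z v = (L2_norm \<Omega> (wave_state \<Omega> z v))\<^sup>2"
  using assms by (simp add: energy_def wave_state_def L2_norm_Pair_sq in_H1_L2)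

text \<open>The gradient is bounded by the H1 norm, so differentiability of z in H1 gives the time
  derivative of its gradient as the gradient of v. The derivative of the state (v, grad z) is thus
  (a, grad v), again of the form \<open>wave_state\<close>.\<close>

lemma wave_state_has_L2_derivative:
  assumes reg: "strong_regularity \<Omega> I z v" and s: "s \<in> I"
    and a: "in_L2 \<Omega> a" and der: "has_time_derivative (L2_norm \<Omega>) v a s I"
  shows "has_L2_derivative \<Omega> (\<lambda>r. wave_state \<Omega> (z r) (v r)) (wave_state \<Omega> (v s) a) s I"
  unfolding has_L2_derivative_def
proof (rule tendsto_sandwich[OF _ _ tendsto_const])
  let ?p = "\<lambda>r. L2_norm \<Omega> (\<lambda>x. (v r x - v s x) / (r - s) - a x)"
  let ?q = "\<lambda>r. H1_norm \<Omega> (\<lambda>x. (z r x - z s x) / (r - s) - v s x)"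
  have "(?p \<longlongrightarrow> 0) (at s within I)" "(?q \<longlongrightarrow> 0) (at s within I)"
    using reg s der by (auto simp: strong_regularity_def has_time_derivative_def)
  from tendsto_add[OF this] show "((\<lambda>r. ?p r + ?q r) \<longlongrightarrow> 0) (at s within I)" by simp
  show "\<forall>\<^sub>F r in at s within I. L2_norm \<Omega> (\<lambda>x. (wave_state \<Omega> (z r) (v r) x - wave_state \<Omega> (z s) (v s) x) /\<^sub>R (r - s)
      - wave_state \<Omega> (v s) a x) \<le> ?p r + ?q r"
    unfolding eventually_at_filter
  proof (intro always_eventually allI impI)
    fix r assume "r \<in> I"
    note regs = strong_regularity_D[OF reg \<open>r \<in> I\<close>] strong_regularity_D[OF reg s]
    note wg = regs(4,5,9,10)[THEN in_H1_has_weak_gradient]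
    define P where "P x = (v r x - v s x) /\<^sub>R (r - s) - a x" for x
    define Q where "Q x = (grad \<Omega> (z r) x - grad \<Omega> (z s) x) /\<^sub>R (r - s) - grad \<Omega> (v s) x" for x
    have "has_weak_gradient \<Omega> (\<lambda>x. (z r x - z s x) / (r - s) - v s x) Q"
      using has_weak_gradient_lincomb[OF has_weak_gradient_lincomb[OF wg(1,3), of 1 1] wg(4),
          of "inverse (r - s)" 1] unfolding Q_def by (simp add: divide_inverse mult.commute)
    from L2_norm_grad_eq[OF this] L2_norm_le_H1_norm(2) have Q: "L2_norm \<Omega> Q \<le> ?q r" by metis
    have "L2_norm \<Omega> (\<lambda>x. (wave_state \<Omega> (z r) (v r) x - wave_state \<Omega> (z s) (v s) x) /\<^sub>R (r - s)
      - wave_state \<Omega> (v s) a x) = L2_norm \<Omega> (\<lambda>x. (P x, Q x))"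
      by (simp add: wave_state_def P_def Q_def)
    also have "\<dots> \<le> L2_norm \<Omega> P + L2_norm \<Omega> Q"
      unfolding P_def Q_def
      by (intro L2_norm_Pair_le in_L2_diff in_L2_scaleR in_H1_L2[OF regs(4)] in_H1_L2[OF regs(5)]
          in_H1_L2[OF regs(9)] in_H1_L2[OF regs(10)] a)
    also have "L2_norm \<Omega> P = ?p r" by (simp add: P_def[abs_def] divide_inverse mult.commute)
    finally show "L2_norm \<Omega> (\<lambda>x. (wave_state \<Omega> (z r) (v r) x - wave_state \<Omega> (z s) (v s) x) /\<^sub>R (r - s)
      - wave_state \<Omega> (v s) a x) \<le> ?p r + ?q r" using Q by linarith
  qed
qed simp

lemma wave_on_D:
  assumes "wave_on \<Omega> I f z v" "s \<in> I"
  shows "in_H2 \<Omega> (z s)" "in_H1 \<Omega> (z s)" "in_H10 \<Omega> (v s)" "in_H1 \<Omega> (v s)" "in_L2 \<Omega> (v s)" "in_L2 \<Omega> f"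
    "in_L2 \<Omega> (wave_state \<Omega> (z s) (v s))"
proof -
  have "strong_regularity \<Omega> I z v" using assms(1) by (simp add: wave_on_def)
  from strong_regularity_D[OF this assms(2)]
  show "in_H2 \<Omega> (z s)" "in_H1 \<Omega> (z s)" "in_H10 \<Omega> (v s)" "in_H1 \<Omega> (v s)" "in_L2 \<Omega> (v s)"
    "in_L2 \<Omega> (wave_state \<Omega> (z s) (v s))"
    by (auto intro: in_H1_L2 in_L2_wave_state)
  show "in_L2 \<Omega> f" using assms(1) by (simp add: wave_on_def)
qed

lemma wave_on_derivative:
  assumes "wave_on \<Omega> I f z v"
  shows "\<exists>a. \<forall>s\<in>I. in_L2 \<Omega> (a s) \<and>
    has_L2_derivative \<Omega> (\<lambda>r. wave_state \<Omega> (z r) (v r)) (wave_state \<Omega> (v s) (a s)) s I \<and>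
    (AE x in lebesgue_on \<Omega>. a s x = laplacian \<Omega> (z s) x + f x)"
proof -
  have reg: "strong_regularity \<Omega> I z v" using assms by (simp add: wave_on_def)
  from assms obtain a where "\<forall>s\<in>I. in_L2 \<Omega> (a s) \<and> has_time_derivative (L2_norm \<Omega>) v (a s) s I \<and>
        (AE x in lebesgue_on \<Omega>. a s x = laplacian \<Omega> (z s) x + f x)"
    unfolding wave_on_def by metis
  with wave_state_has_L2_derivative[OF reg] show ?thesis by blast
qed

lemma wave_on_subset:
  assumes "wave_on \<Omega> I f z v" "J \<subseteq> I"
  shows "wave_on \<Omega> J f z v"
  using assms
  unfolding wave_on_def strong_regularity_def time_continuous_on_def has_time_derivative_def
  by (meson subsetD tendsto_within_subset)

lemma wave_on_continuous_on:
  assumes w: "wave_on \<Omega> I f z v" and c: "in_L2 \<Omega> c"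
  shows "continuous_on I (\<lambda>s. L2_norm \<Omega> (\<lambda>x. wave_state \<Omega> (z s) (v s) x - c x))"
proof (rule L2_continuous_imp_continuous_on_norm[OF _ wave_on_D(7)[OF w] c])
  fix s assume s: "s \<in> I"
  obtain a where a': "\<forall>s\<in>I. in_L2 \<Omega> (a s) \<and>
      has_L2_derivative \<Omega> (\<lambda>r. wave_state \<Omega> (z r) (v r)) (wave_state \<Omega> (v s) (a s)) s I \<and>
      (AE x in lebesgue_on \<Omega>. a s x = laplacian \<Omega> (z s) x + f x)"
    using wave_on_derivative[OF w] ..
  note a = bspec[OF a', THEN conjunct1] bspec[OF a', THEN conjunct2, THEN conjunct1]
    bspec[OF a', THEN conjunct2, THEN conjunct2]
  show "((\<lambda>r. L2_norm \<Omega> (\<lambda>x. wave_state \<Omega> (z r) (v r) x - wave_state \<Omega> (z s) (v s) x)) \<longlongrightarrow> 0) (at s within I)"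
    by (rule has_L2_derivative_imp_continuous[OF a(2)[OF s] wave_on_D(7)[OF w]
          in_L2_wave_state[OF wave_on_D(4)[OF w s] a(1)[OF s]] s])
qed

lemma wave_on_continuous_on_velocity:
  assumes w: "wave_on \<Omega> I f z v" and c: "in_L2 \<Omega> c"
  shows "continuous_on I (\<lambda>s. L2_norm \<Omega> (\<lambda>x. v s x - c x))"
proof (rule L2_continuous_imp_continuous_on_norm[OF _ wave_on_D(5)[OF w] c])
  fix s assume s: "s \<in> I"
  have "((\<lambda>r. H1_norm \<Omega> (\<lambda>x. v r x - v s x)) \<longlongrightarrow> 0) (at s within I)"
    using w s by (simp add: wave_on_def strong_regularity_def time_continuous_on_def)
  then show "((\<lambda>r. L2_norm \<Omega> (\<lambda>x. v r x - v s x)) \<longlongrightarrow> 0) (at s within I)"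
    by (rule Lim_null_comparison[rotated]) (simp add: L2_norm_le_H1_norm)
qed

text \<open>The sum is symmetrised since only then do the gradient terms cancel by Green's formula.\<close>

lemma wave_energy_balance:
  assumes z: "in_H2 \<Omega> z" and w: "in_H2 \<Omega> w" and v: "in_H10 \<Omega> v" and u: "in_H10 \<Omega> u"
    and L2: "in_L2 \<Omega> a" "in_L2 \<Omega> b" "in_L2 \<Omega> f" "in_L2 \<Omega> g"
    and a: "AE x in lebesgue_on \<Omega>. a x = laplacian \<Omega> z x + f x"
    and b: "AE x in lebesgue_on \<Omega>. b x = laplacian \<Omega> w x + g x"
  shows "L2_inner \<Omega> (wave_state \<Omega> z v) (wave_state \<Omega> u b) + L2_inner \<Omega> (wave_state \<Omega> w u) (wave_state \<Omega> v a)
     = L2_inner \<Omega> v g + L2_inner \<Omega> u f"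
proof -
  have H1: "in_H1 \<Omega> z" "in_H1 \<Omega> w" "in_H1 \<Omega> v" "in_H1 \<Omega> u"
    using z w v u by (auto simp: in_H2_def in_H10_def)
  note L = in_H1_L2[OF H1(3)] in_H1_L2[OF H1(4)] in_L2_laplacian[OF z] in_L2_laplacian[OF w]
  have "L2_inner \<Omega> b v = L2_inner \<Omega> (laplacian \<Omega> w) v + L2_inner \<Omega> g v"
    using L2_inner_cong_AE[OF L2(2) in_L2_add[OF L(6) L2(4)] L(1) b] L2_inner_add_left[OF L(6) L2(4) L(1)] by simp
  moreover have "L2_inner \<Omega> a u = L2_inner \<Omega> (laplacian \<Omega> z) u + L2_inner \<Omega> f u"
    using L2_inner_cong_AE[OF L2(1) in_L2_add[OF L(5) L2(3)] L(3) a] L2_inner_add_left[OF L(5) L2(3) L(3)] by simp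
  ultimately show ?thesis
    using Green_H2_H10[OF z u] Green_H2_H10[OF w v]
    by (simp add: L2_inner_wave_state[OF H1(1) H1(4) L(1) L2(2)] L2_inner_wave_state[OF H1(2) H1(3) L(3) L2(1)]
        L2_inner_commute[of \<Omega> v] L2_inner_commute[of \<Omega> u])
qed

text \<open>The energy balance of the wave with itself says that the inner product of the state with
  its derivative is that of v with f, which is at most the norm of the state times that of
  f.\<close>

lemma wave_norm_Lipschitz:
  assumes w: "wave_on \<Omega> I f z v" and "convex I" "r \<in> I" "s \<in> I"
  shows "\<bar>L2_norm \<Omega> (wave_state \<Omega> (z s) (v s)) - L2_norm \<Omega> (wave_state \<Omega> (z r) (v r))\<bar>
     \<le> L2_norm \<Omega> f * \<bar>s - r\<bar>"
proof -
  obtain a where a': "\<forall>s\<in>I. in_L2 \<Omega> (a s) \<and>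
      has_L2_derivative \<Omega> (\<lambda>r. wave_state \<Omega> (z r) (v r)) (wave_state \<Omega> (v s) (a s)) s I \<and>
      (AE x in lebesgue_on \<Omega>. a s x = laplacian \<Omega> (z s) x + f x)"
    using wave_on_derivative[OF w] ..
  note a = bspec[OF a', THEN conjunct1] bspec[OF a', THEN conjunct2, THEN conjunct1]
    bspec[OF a', THEN conjunct2, THEN conjunct2]
  show ?thesis
  proof (rule L2_norm_Lipschitz[where A = "\<lambda>s. wave_state \<Omega> (v s) (a s)" and I = I])
    fix s assume s: "s \<in> I"
    note d = wave_on_D[OF w s]
    show "in_L2 \<Omega> (wave_state \<Omega> (v s) (a s))" by (rule in_L2_wave_state[OF d(4) a(1)[OF s]])
    have "L2_inner \<Omega> (wave_state \<Omega> (z s) (v s)) (wave_state \<Omega> (v s) (a s)) = L2_inner \<Omega> (v s) f"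
      using wave_energy_balance[OF d(1) d(1) d(3) d(3) a(1)[OF s] a(1)[OF s] d(6) d(6) a(3)[OF s] a(3)[OF s]]
      by simp
    also have "\<bar>\<dots>\<bar> \<le> L2_norm \<Omega> (v s) * L2_norm \<Omega> f"
      by (rule L2_Cauchy_Schwarz[OF d(5,6)])
    also have "\<dots> \<le> L2_norm \<Omega> (wave_state \<Omega> (z s) (v s)) * L2_norm \<Omega> f"
      unfolding wave_state_def by (intro mult_right_mono L2_norm_fst_le_Pair d(5) in_H1_L2(2) d(2)) simp
    finally show "\<bar>L2_inner \<Omega> (wave_state \<Omega> (z s) (v s)) (wave_state \<Omega> (v s) (a s))\<bar>
        \<le> L2_norm \<Omega> f * L2_norm \<Omega> (wave_state \<Omega> (z s) (v s))" by (simp add: mult.commute)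
  qed (use assms a(2) wave_on_D(7)[OF w] in auto)
qed

text \<open>Expanding the inner product of the differences gives four terms, settled by two balances
  of each wave with itself and one mixed balance. This avoids showing that the difference is itself
  a wave, and hence any linearity of the Laplacian.\<close>

lemma wave_norm_diff_Lipschitz:
  assumes w: "wave_on \<Omega> I f z v" and w': "wave_on \<Omega> I g y u" and "convex I" "r \<in> I" "s \<in> I"
  shows "\<bar>L2_norm \<Omega> (\<lambda>x. wave_state \<Omega> (z s) (v s) x - wave_state \<Omega> (y s) (u s) x)
       - L2_norm \<Omega> (\<lambda>x. wave_state \<Omega> (z r) (v r) x - wave_state \<Omega> (y r) (u r) x)\<bar>
     \<le> L2_norm \<Omega> (\<lambda>x. f x - g x) * \<bar>s - r\<bar>"
proof -
  obtain a where a': "\<forall>s\<in>I. in_L2 \<Omega> (a s) \<and>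
      has_L2_derivative \<Omega> (\<lambda>r. wave_state \<Omega> (z r) (v r)) (wave_state \<Omega> (v s) (a s)) s I \<and>
      (AE x in lebesgue_on \<Omega>. a s x = laplacian \<Omega> (z s) x + f x)"
    using wave_on_derivative[OF w] ..
  note a = bspec[OF a', THEN conjunct1] bspec[OF a', THEN conjunct2, THEN conjunct1]
    bspec[OF a', THEN conjunct2, THEN conjunct2]
  obtain b where b': "\<forall>s\<in>I. in_L2 \<Omega> (b s) \<and>
      has_L2_derivative \<Omega> (\<lambda>r. wave_state \<Omega> (y r) (u r)) (wave_state \<Omega> (u s) (b s)) s I \<and>
      (AE x in lebesgue_on \<Omega>. b s x = laplacian \<Omega> (y s) x + g x)"
    using wave_on_derivative[OF w'] ..
  note b = bspec[OF b', THEN conjunct1] bspec[OF b', THEN conjunct2, THEN conjunct1]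
    bspec[OF b', THEN conjunct2, THEN conjunct2]
  let ?U = "\<lambda>s. wave_state \<Omega> (z s) (v s)" and ?V = "\<lambda>s. wave_state \<Omega> (y s) (u s)"
  let ?A = "\<lambda>s. wave_state \<Omega> (v s) (a s)" and ?B = "\<lambda>s. wave_state \<Omega> (u s) (b s)"
  show ?thesis
  proof (rule L2_norm_Lipschitz[where A = "\<lambda>s x. ?A s x - ?B s x" and I = I])
    fix s assume s: "s \<in> I"
    note d = wave_on_D[OF w s] and d' = wave_on_D[OF w' s]
    have A: "in_L2 \<Omega> (?A s)" by (rule in_L2_wave_state[OF d(4) a(1)[OF s]])
    have B: "in_L2 \<Omega> (?B s)" by (rule in_L2_wave_state[OF d'(4) b(1)[OF s]])
    show "in_L2 \<Omega> (\<lambda>x. ?A s x - ?B s x)" by (rule in_L2_diff[OF A B])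
    show "in_L2 \<Omega> (\<lambda>x. ?U s x - ?V s x)" by (rule in_L2_diff[OF d(7) d'(7)])
    show "has_L2_derivative \<Omega> (\<lambda>s x. ?U s x - ?V s x) (\<lambda>x. ?A s x - ?B s x) s I"
      by (rule has_L2_derivative_diff[OF a(2)[OF s] b(2)[OF s] wave_on_D(7)[OF w] wave_on_D(7)[OF w'] A B s])
    have "L2_inner \<Omega> (\<lambda>x. ?U s x - ?V s x) (\<lambda>x. ?A s x - ?B s x)
       = L2_inner \<Omega> (?U s) (?A s) + L2_inner \<Omega> (?V s) (?B s)
         - (L2_inner \<Omega> (?U s) (?B s) + L2_inner \<Omega> (?V s) (?A s))"
      by (simp add: L2_inner_diff_left[OF d(7) d'(7) in_L2_diff[OF A B]]
          L2_inner_diff_right[OF A B d(7)] L2_inner_diff_right[OF A B d'(7)])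
    also have "\<dots> = L2_inner \<Omega> (v s) f + L2_inner \<Omega> (u s) g - (L2_inner \<Omega> (v s) g + L2_inner \<Omega> (u s) f)"
      using wave_energy_balance[OF d(1) d(1) d(3) d(3) a(1)[OF s] a(1)[OF s] d(6) d(6) a(3)[OF s] a(3)[OF s]]
        wave_energy_balance[OF d'(1) d'(1) d'(3) d'(3) b(1)[OF s] b(1)[OF s] d'(6) d'(6) b(3)[OF s] b(3)[OF s]]
        wave_energy_balance[OF d(1) d'(1) d(3) d'(3) a(1)[OF s] b(1)[OF s] d(6) d'(6) a(3)[OF s] b(3)[OF s]]
      by simp
    also have "\<dots> = L2_inner \<Omega> (\<lambda>x. v s x - u s x) (\<lambda>x. f x - g x)"
      by (simp add: L2_inner_diff_left[OF d(5) d'(5) in_L2_diff[OF d(6) d'(6)]]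
          L2_inner_diff_right[OF d(6) d'(6) d(5)] L2_inner_diff_right[OF d(6) d'(6) d'(5)])
    also have "\<bar>\<dots>\<bar> \<le> L2_norm \<Omega> (\<lambda>x. v s x - u s x) * L2_norm \<Omega> (\<lambda>x. f x - g x)"
      by (intro L2_Cauchy_Schwarz in_L2_diff d d')
    also have "\<dots> \<le> L2_norm \<Omega> (\<lambda>x. ?U s x - ?V s x) * L2_norm \<Omega> (\<lambda>x. f x - g x)"
      unfolding wave_state_def diff_Pair
      by (intro mult_right_mono L2_norm_fst_le_Pair in_L2_diff d d' in_H1_L2(2)) simp
    finally show "\<bar>L2_inner \<Omega> (\<lambda>x. ?U s x - ?V s x) (\<lambda>x. ?A s x - ?B s x)\<bar>
        \<le> L2_norm \<Omega> (\<lambda>x. f x - g x) * L2_norm \<Omega> (\<lambda>x. ?U s x - ?V s x)" by (simp add: mult.commute)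
  qed (use assms in auto)
qed

end


section \<open>Triggering instants\<close>

text \<open>The accumulation argument separated from the equation: \<open>U k\<close> stands for the
  state along the prolonged k-th piece. In \<open>compare\<close> the sum of two norms appears
  because the difference of two held sources is bounded by the sum of their norms.\<close>

lemma no_finite_accumulation:
  fixes \<Omega> :: "'a::euclidean_space set" and U :: "nat \<Rightarrow> real \<Rightarrow> 'a \<Rightarrow> 'b::euclidean_space" and \<tau> :: "nat \<Rightarrow> real"
  defines "n \<equiv> \<lambda>k. L2_norm \<Omega> (U k (\<tau> k))"
  assumes \<tau>: "incseq \<tau>" "\<tau> \<longlonglongrightarrow> T"
    and \<alpha>: "\<alpha> > 0" and c: "c > 0" and n_pos: "\<And>k. n k > 0"
    and U: "\<And>k s. \<tau> k \<le> s \<Longrightarrow> in_L2 \<Omega> (U k s)"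
    and cont: "\<And>k r. \<tau> k \<le> r \<Longrightarrow> continuous_on {\<tau> k..} (\<lambda>s. L2_norm \<Omega> (\<lambda>x. U k s x - U k r x))"
    and growth: "\<And>k s. \<tau> k \<le> s \<Longrightarrow> \<bar>L2_norm \<Omega> (U k s) - n k\<bar> \<le> \<alpha> * (s - \<tau> k) * n k"
    and compare: "\<And>j k s. k \<le> j \<Longrightarrow> \<tau> j \<le> s \<Longrightarrow> L2_norm \<Omega> (\<lambda>x. U j s x - U k s x)
        \<le> L2_norm \<Omega> (\<lambda>x. U j (\<tau> j) x - U k (\<tau> j) x) + \<alpha> * (s - \<tau> j) * (n j + n k)"
    and glue: "\<And>k. AE x in lebesgue_on \<Omega>. U k (\<tau> (Suc k)) x = U (Suc k) (\<tau> (Suc k)) x"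
    and jump: "\<And>k. L2_norm \<Omega> (\<lambda>x. U k (\<tau> (Suc k)) x - U k (\<tau> k) x) \<ge> c * n (Suc k)"
  shows False
proof -
  \<comment> \<open>The first bound keeps the relative drift of the norm, 2 \<alpha> \<eta>, below
    1/2. The second keeps each deviation 3 \<alpha> \<eta> n(K) below c n(K) / 8, so two of them use
    up only half of the lower bound c n(K) / 2.\<close>
  define \<eta> where "\<eta> = min (1 / (4 * \<alpha>)) (c / (24 * \<alpha>))"
  have "\<eta> > 0" and \<eta>: "4 * (\<alpha> * \<eta>) \<le> 1" "24 * (\<alpha> * \<eta>) \<le> c"
    using \<alpha> c by (auto simp: \<eta>_def min_def field_simps)
  have le_T: "\<tau> k \<le> T" for k using incseq_le[OF \<tau>] .
  have mono: "\<tau> j \<le> \<tau> k" if "j \<le> k" for j k using \<tau>(1) that by (simp add: incseqD)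
  obtain K where "T - \<tau> K < \<eta>"
  proof -
    have "\<forall>\<^sub>F k in sequentially. T - \<eta> < \<tau> k"
      by (rule order_tendstoD(1)[OF \<tau>(2)]) (use \<open>\<eta> > 0\<close> in simp)
    then obtain k where "T - \<eta> < \<tau> k" by (auto simp: eventually_sequentially)
    then show ?thesis using that[of k] by simp
  qed
  then have short: "\<tau> j - \<tau> K < \<eta>" for j using le_T[of j] by simp
  have short': "\<alpha> * (\<tau> j - \<tau> K) \<le> \<alpha> * \<eta>" for j
    using short[of j] \<alpha> by simp
  have n_Suc: "n (Suc k) = L2_norm \<Omega> (U k (\<tau> (Suc k)))" for k
    unfolding n_def using L2_norm_cong_AE[OF U U glue, of k] mono[of k "Suc k"] by simp
  \<comment> \<open>The factor 2 closes the induction: while the drift is at most n(K) / 2, the norm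
    n(j) stays below 2 n(K), so the next step adds at most 2 \<alpha> n(K) times its length.\<close>
  have n_close: "\<bar>n j - n K\<bar> \<le> 2 * (\<alpha> * (\<tau> j - \<tau> K)) * n K" if "K \<le> j" for j
    using that
  proof (induction j rule: dec_induct)
    case (step j)
    have "2 * (\<alpha> * (\<tau> j - \<tau> K)) * n K \<le> (1/2) * n K"
      using short'[of j] \<eta>(1) n_pos[of K] by (intro mult_right_mono) auto
    then have "n j \<le> 2 * n K" using step.IH n_pos[of K] by linarith
    then have "\<alpha> * (\<tau> (Suc j) - \<tau> j) * n j \<le> \<alpha> * (\<tau> (Suc j) - \<tau> j) * (2 * n K)"
      using \<alpha> mono[of j "Suc j"] by (intro mult_left_mono) auto
    moreover have "\<bar>n (Suc j) - n j\<bar> \<le> \<alpha> * (\<tau> (Suc j) - \<tau> j) * n j"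
      unfolding n_Suc using growth[of j "\<tau> (Suc j)"] mono[of j "Suc j"] by simp
    moreover have "2 * (\<alpha> * (\<tau> (Suc j) - \<tau> K)) * n K
        = \<alpha> * (\<tau> (Suc j) - \<tau> j) * (2 * n K) + 2 * (\<alpha> * (\<tau> j - \<tau> K)) * n K"
      by (simp add: algebra_simps)
    ultimately show ?case using step.IH by linarith
  qed simp
  have n_bounds: "n K / 2 \<le> n j" "n j \<le> 2 * n K" if "K \<le> j" for j
  proof -
    have "2 * (\<alpha> * (\<tau> j - \<tau> K)) * n K \<le> (1/2) * n K"
      using short'[of j] \<eta>(1) n_pos[of K] by (intro mult_right_mono) auto
    then show "n K / 2 \<le> n j" "n j \<le> 2 * n K" using n_close[OF that] n_pos[of K] by linarith+
  qed
  \<comment> \<open>Deviation of the actual trajectory from the prolonged K-th piece at the j-th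
    instant; it starts from 0 at j = K.\<close>
  define d where "d j = L2_norm \<Omega> (\<lambda>x. U j (\<tau> j) x - U K (\<tau> j) x)" for j
  have step_bound: "L2_norm \<Omega> (\<lambda>x. U j (\<tau> (Suc j)) x - U K (\<tau> (Suc j)) x)
      \<le> d j + \<alpha> * (\<tau> (Suc j) - \<tau> j) * (3 * n K)" if "K \<le> j" for j
  proof -
    have "\<alpha> * (\<tau> (Suc j) - \<tau> j) * (n j + n K) \<le> \<alpha> * (\<tau> (Suc j) - \<tau> j) * (3 * n K)"
      using \<alpha> mono[of j "Suc j"] n_bounds(2)[OF that] by (intro mult_left_mono) auto
    then show ?thesis using compare[OF that, of "\<tau> (Suc j)"] mono[of j "Suc j"] by (simp add: d_def)
  qed
  have d_Suc: "d (Suc j) = L2_norm \<Omega> (\<lambda>x. U j (\<tau> (Suc j)) x - U K (\<tau> (Suc j)) x)" if "K \<le> j" for j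
    unfolding d_def
    by (rule L2_norm_cong_AE)
       (use glue[of j] that mono in \<open>auto intro!: in_L2_diff U elim!: eventually_mono\<close>)
  have d_bound: "d j \<le> \<alpha> * (\<tau> j - \<tau> K) * (3 * n K)" if "K \<le> j" for j
    using that
  proof (induction j rule: dec_induct)
    case (step j)
    have "\<alpha> * (\<tau> (Suc j) - \<tau> K) * (3 * n K)
        = \<alpha> * (\<tau> (Suc j) - \<tau> j) * (3 * n K) + \<alpha> * (\<tau> j - \<tau> K) * (3 * n K)"
      by (simp add: algebra_simps)
    then show ?case using step.IH step_bound[OF step.hyps(1)] d_Suc[OF step.hyps(1)]
      by linarith
  qed (simp add: d_def)
  define D where "D s = L2_norm \<Omega> (\<lambda>x. U K s x - U K T x)" for s
  \<comment> \<open>The jump of piece j is compared along a detour through the K-th prolongation: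
    over to \<open>U K\<close> at \<tau>(j+1), on to its value at T, back to \<tau>(j), and over to
    piece j. The two crossings cost d, the two middle legs D.\<close>
  have lower: "c * n K / 4 \<le> D (\<tau> (Suc j)) + D (\<tau> j)" if j: "K \<le> j" for j
  proof -
    have in1: "in_L2 \<Omega> (U j (\<tau> (Suc j)))" "in_L2 \<Omega> (U j (\<tau> j))" "in_L2 \<Omega> (U K (\<tau> (Suc j)))"
      "in_L2 \<Omega> (U K (\<tau> j))" "in_L2 \<Omega> (U K T)"
      using j mono le_T by (auto intro!: U)
    have small: "\<alpha> * (\<tau> i - \<tau> K) * (3 * n K) \<le> c * n K / 8" for i
    proof -
      have "\<alpha> * (\<tau> i - \<tau> K) * (3 * n K) \<le> (c / 24) * (3 * n K)"
        using short'[of i] \<eta>(2) n_pos[of K] by (intro mult_right_mono) auto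
      then show ?thesis by simp
    qed
    have "c * (n K / 2) \<le> c * n (Suc j)" using c n_bounds(1)[of "Suc j"] j by (intro mult_left_mono) auto
    also have "\<dots> \<le> L2_norm \<Omega> (\<lambda>x. U j (\<tau> (Suc j)) x - U j (\<tau> j) x)" by (rule jump)
    also have "\<dots> \<le> d (Suc j) + L2_norm \<Omega> (\<lambda>x. U K (\<tau> (Suc j)) x - U j (\<tau> j) x)"
      unfolding d_Suc[OF j] by (rule L2_dist_triangle[OF in1(1,3,2)])
    also have "L2_norm \<Omega> (\<lambda>x. U K (\<tau> (Suc j)) x - U j (\<tau> j) x)
        \<le> D (\<tau> (Suc j)) + L2_norm \<Omega> (\<lambda>x. U K T x - U j (\<tau> j) x)"
      unfolding D_def by (rule L2_dist_triangle[OF in1(3,5,2)])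
    also have "L2_norm \<Omega> (\<lambda>x. U K T x - U j (\<tau> j) x) \<le> D (\<tau> j) + d j"
      unfolding D_def d_def
      using L2_dist_triangle[OF in1(5,4,2)]
      by (simp add: L2_norm_minus_commute[of \<Omega> "U K T"] L2_norm_minus_commute[of \<Omega> "U K (\<tau> j)" "U j (\<tau> j)"])
    finally show ?thesis
      using d_bound[OF j] d_bound[of "Suc j"] small[of j] small[of "Suc j"] j by simp
  qed
  \<comment> \<open>The prolongation with frozen input exists past T, so it is continuous there, and
    D(T) = 0.\<close>
  have "continuous_on {\<tau> K..} D" unfolding D_def by (rule cont[OF le_T])
  then have "(\<lambda>j. D (\<tau> j)) \<longlonglongrightarrow> D T"
    by (rule continuous_on_tendsto_compose[OF _ \<tau>(2)])
       (use le_T mono in \<open>auto simp: eventually_sequentially\<close>)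
  then have lim: "(\<lambda>j. D (\<tau> j)) \<longlonglongrightarrow> 0" by (simp add: D_def)
  have "(\<lambda>j. D (\<tau> (Suc j)) + D (\<tau> j)) \<longlonglongrightarrow> 0 + 0"
    by (intro tendsto_add LIMSEQ_Suc lim)
  from LIMSEQ_le_const[OF this, of "c * n K / 4"] have "c * n K / 4 \<le> 0"
    using lower by auto
  then show False using mult_pos_pos[OF c n_pos[of K]] by simp
qed

text \<open>Damping and error combine so that the current velocity cancels and only the held input
  remains.\<close>

lemma (in bounded_open) sampled_wave_imp_wave_on:
  assumes reg: "strong_regularity \<Omega> I z v" and "\<tau> \<in> I"
    and eq: "sampled_wave_equation_on \<Omega> \<alpha> \<tau> I z v"
  shows "wave_on \<Omega> I (\<lambda>x. - \<alpha> *\<^sub>R v \<tau> x) z v"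
  unfolding wave_on_def
proof (intro conjI ballI reg)
  show "in_L2 \<Omega> (\<lambda>x. - \<alpha> *\<^sub>R v \<tau> x)"
    by (intro in_L2_scaleR in_H1_L2 strong_regularity_D[OF reg \<open>\<tau> \<in> I\<close>])
  fix s assume "s \<in> I"
  with eq obtain a where a: "in_L2 \<Omega> a" "has_time_derivative (L2_norm \<Omega>) v a s I"
    "AE x in lebesgue_on \<Omega>. a x - laplacian \<Omega> (z s) x = - \<alpha> * v s x + \<alpha> * sampling_error v \<tau> s x"
    unfolding sampled_wave_equation_on_def ae_eq_def by blast
  have "AE x in lebesgue_on \<Omega>. a x = laplacian \<Omega> (z s) x + - \<alpha> *\<^sub>R v \<tau> x"
    using a(3) by eventually_elim (simp add: sampling_error_def algebra_simps)
  with a show "\<exists>a. in_L2 \<Omega> a \<and> has_time_derivative (L2_norm \<Omega>) v a s I \<and>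
      (AE x in lebesgue_on \<Omega>. a x = laplacian \<Omega> (z s) x + - \<alpha> *\<^sub>R v \<tau> x)" by blast
qed

lemma next_event_ge: "ereal \<tau> \<le> next_event \<Omega> \<gamma> \<tau> z v"
  unfolding next_event_def by (rule Inf_greatest) auto

text \<open>The infimum may fail to be attained, so only the non-strict inequality can hold at
  \<sigma>. If even that failed, continuity would exclude violations in a neighbourhood of \<sigma>,
  and the infimum would exceed \<sigma>.\<close>

lemma (in bounded_open) error_at_next_event:
  assumes w: "wave_on \<Omega> {\<tau>..} f z v" and \<gamma>: "\<gamma> > 0" and ev: "next_event \<Omega> \<gamma> \<tau> z v = ereal \<sigma>"
  shows "sqrt \<gamma> * L2_norm \<Omega> (wave_state \<Omega> (z \<sigma>) (v \<sigma>)) \<le> L2_norm \<Omega> (\<lambda>x. v \<sigma> x - v \<tau> x)"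
proof (rule ccontr)
  assume neg: "\<not> ?thesis"
  have "\<tau> \<le> \<sigma>" using next_event_ge[of \<tau> \<Omega> \<gamma> z v] ev by simp
  \<comment> \<open>The criterion after taking square roots. The \<open>- 0\<close> matches
    \<open>wave_on_continuous_on\<close> with c the zero function.\<close>
  define F where "F s = L2_norm \<Omega> (\<lambda>x. v s x - v \<tau> x)
      - sqrt \<gamma> * L2_norm \<Omega> (\<lambda>x. wave_state \<Omega> (z s) (v s) x - 0)" for s
  have "continuous_on {\<tau>..} F"
    unfolding F_def using wave_on_D(5)[OF w, of \<tau>]
    by (intro continuous_intros wave_on_continuous_on[OF w] wave_on_continuous_on_velocity[OF w]) auto
  then have "(F \<longlongrightarrow> F \<sigma>) (at \<sigma> within {\<tau>..})" using \<open>\<tau> \<le> \<sigma>\<close> by (simp add: continuous_on_def)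
  moreover have "F \<sigma> < 0" using neg by (simp add: F_def)
  ultimately have "\<forall>\<^sub>F s in at \<sigma> within {\<tau>..}. F s < 0" by (rule order_tendstoD(2))
  then obtain \<delta> where "\<delta> > 0" and \<delta>: "\<And>s. s \<in> {\<tau>..} \<Longrightarrow> s \<noteq> \<sigma> \<Longrightarrow> dist s \<sigma> < \<delta> \<Longrightarrow> F s < 0"
    by (auto simp: eventually_at)
  have "ereal (\<sigma> + \<delta>) \<le> next_event \<Omega> \<gamma> \<tau> z v"
    unfolding next_event_def
  proof (rule Inf_greatest, clarify)
    fix s assume s: "\<tau> \<le> s"
      and viol: "2 * \<gamma> * energy \<Omega> (z s) (v s) < (L2_norm \<Omega> (sampling_error v \<tau> s))\<^sup>2"
    have "ereal \<sigma> \<le> ereal s"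
      unfolding ev[symmetric] next_event_def by (rule Inf_lower) (use s viol in auto)
    then have "\<sigma> \<le> s" by simp
    have "2 * energy \<Omega> (z s) (v s) = (L2_norm \<Omega> (wave_state \<Omega> (z s) (v s)))\<^sup>2"
      using wave_on_D[OF w, of s] s by (intro energy_wave_state) auto
    then have "(sqrt \<gamma> * L2_norm \<Omega> (wave_state \<Omega> (z s) (v s)))\<^sup>2 = 2 * \<gamma> * energy \<Omega> (z s) (v s)"
      using \<gamma> by (simp add: power_mult_distrib)
    with viol have "(sqrt \<gamma> * L2_norm \<Omega> (wave_state \<Omega> (z s) (v s)))\<^sup>2 < (L2_norm \<Omega> (\<lambda>x. v s x - v \<tau> x))\<^sup>2"
      by (simp add: sampling_error_def)
    then have "F s > 0" unfolding F_def by (simp add: power2_less_imp_less)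
    \<comment> \<open>The punctured neighbourhood omits s = \<sigma>, where the sign of F gives the
      contradiction directly.\<close>
    then have "\<not> dist s \<sigma> < \<delta>" using \<delta>[of s] \<open>F \<sigma> < 0\<close> s by fastforce
    then show "ereal (\<sigma> + \<delta>) \<le> ereal s" using \<open>\<sigma> \<le> s\<close> by (simp add: dist_real_def)
  qed
  then show False using ev \<open>\<delta> > 0\<close> by simp
qed

text \<open>At rest the held input has norm 0, so the Lipschitz bound keeps the state at 0 forever.
  The error stays 0 and cannot strictly exceed a nonnegative threshold, so the infimum is over the
  empty set.\<close>

lemma (in bounded_open) next_event_of_rest:
  assumes w: "wave_on \<Omega> {\<tau>..} (\<lambda>x. - \<alpha> *\<^sub>R v \<tau> x) z v" and \<gamma>: "\<gamma> > 0"
    and rest: "L2_norm \<Omega> (wave_state \<Omega> (z \<tau>) (v \<tau>)) = 0"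
  shows "next_event \<Omega> \<gamma> \<tau> z v = \<infinity>"
proof -
  have v_le: "L2_norm \<Omega> (v s) \<le> L2_norm \<Omega> (wave_state \<Omega> (z s) (v s))" if "\<tau> \<le> s" for s
    unfolding wave_state_def using wave_on_D[OF w, of s] that
    by (intro L2_norm_fst_le_Pair in_H1_L2(2)) auto
  have v\<tau>: "L2_norm \<Omega> (v \<tau>) = 0" using v_le[of \<tau>] rest L2_norm_nonneg[of \<Omega> "v \<tau>"] by simp
  have "L2_norm \<Omega> (sampling_error v \<tau> s) = 0 \<and> 0 \<le> energy \<Omega> (z s) (v s)" if s: "\<tau> \<le> s" for s
  proof -
    have "\<bar>L2_norm \<Omega> (wave_state \<Omega> (z s) (v s)) - L2_norm \<Omega> (wave_state \<Omega> (z \<tau>) (v \<tau>))\<bar>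
        \<le> L2_norm \<Omega> (\<lambda>x. - \<alpha> *\<^sub>R v \<tau> x) * \<bar>s - \<tau>\<bar>"
      by (rule wave_norm_Lipschitz[OF w]) (use s in auto)
    also have "L2_norm \<Omega> (\<lambda>x. - \<alpha> *\<^sub>R v \<tau> x) = 0" by (simp only: L2_norm_scaleR v\<tau> mult_zero_right)
    finally have "L2_norm \<Omega> (wave_state \<Omega> (z s) (v s)) = 0"
      using rest L2_norm_nonneg[of \<Omega> "wave_state \<Omega> (z s) (v s)"] by simp
    then have "L2_norm \<Omega> (v s) = 0" using v_le[OF s] L2_norm_nonneg[of \<Omega> "v s"] by simp
    then have "L2_norm \<Omega> (\<lambda>x. v s x - v \<tau> x) \<le> 0"
      using L2_norm_triangle_diff[of \<Omega> "v s" "v \<tau>"] v\<tau> wave_on_D(5)[OF w, of s] wave_on_D(5)[OF w, of \<tau>] s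
      by simp
    then show ?thesis
      using L2_norm_nonneg[of \<Omega> "\<lambda>x. v s x - v \<tau> x"] by (simp add: sampling_error_def energy_def)
  qed
  then have "{ereal s | s. \<tau> \<le> s \<and> (L2_norm \<Omega> (sampling_error v \<tau> s))\<^sup>2 > 2 * \<gamma> * energy \<Omega> (z s) (v s)} = {}"
    using \<gamma> by (auto simp: not_less)
  then show ?thesis unfolding next_event_def by (simp only: Inf_empty top_ereal_def)
qed

theorem theorem2p3:
  fixes \<Omega> :: "(real ^ 'n) set"
    and \<alpha> \<gamma> :: real
    and z0 z1 :: "real ^ 'n \<Rightarrow> real"
    and t :: "nat \<Rightarrow> ereal"
    and z v :: "real \<Rightarrow> real ^ 'n \<Rightarrow> real"
  assumes "bounded_smooth_domain \<Omega>"
    and "\<alpha> > 0" and "\<gamma> > 0"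
    and "in_H2 \<Omega> z0" and "in_H10 \<Omega> z0" and "in_H10 \<Omega> z1"
    and "closed_loop_solution \<Omega> \<alpha> \<gamma> z0 z1 t z v"
  shows "\<not> zeno t \<and> maximal_time t = \<infinity>"
proof -
  interpret bounded_open \<Omega>
    using assms(1) by unfold_locales (auto simp: bounded_smooth_domain_def)
  have t0: "t 0 = 0" and t_inf: "\<And>k. t k = \<infinity> \<Longrightarrow> t (Suc k) = \<infinity>"
    and piece: "\<And>k \<tau>. t k = ereal \<tau> \<Longrightarrow> \<exists>\<zeta> \<nu>. strong_regularity \<Omega> {\<tau>..} \<zeta> \<nu> \<and>
           sampled_wave_equation_on \<Omega> \<alpha> \<tau> {\<tau>..} \<zeta> \<nu> \<and>
           (\<forall>s. \<tau> \<le> s \<and> ereal s \<le> t (Suc k) \<longrightarrow> ae_eq \<Omega> (\<zeta> s) (z s) \<and> ae_eq \<Omega> (\<nu> s) (v s)) \<and>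
           t (Suc k) = next_event \<Omega> \<gamma> \<tau> \<zeta> \<nu>"
    using assms(7) unfolding closed_loop_solution_def by blast+
  \<comment> \<open>No clause constrains the successor of an instant -\<infinity>; the induction in
    \<open>t_nonneg\<close>, started at \<open>t 0 = 0\<close>, rules that value out.\<close>
  have t_step: "t k \<le> t (Suc k)" if "t k \<noteq> -\<infinity>" for k
  proof (cases "t k")
    case (real \<tau>)
    then show ?thesis using piece[OF real] next_event_ge by metis
  qed (use that t_inf in auto)
  have t_nonneg: "0 \<le> t k" for k
  proof (induction k)
    case (Suc k)
    then show ?case using t_step[of k] by fastforce
  qed (simp add: t0)
  have t_inc: "incseq t"
  proof (rule incseq_SucI)
    show "t k \<le> t (Suc k)" for k using t_step[of k] t_nonneg[of k] by fastforce
  qed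
  \<comment> \<open>Both conclusions reduce to this. If it fails, all instants are real, so every
    piece has a finite next event.\<close>
  have unbounded: "\<exists>k. ereal B < t k" for B
  proof (rule ccontr)
    assume "\<not> ?thesis"
    then have B: "t k \<le> ereal B" for k by (simp add: not_less)
    define \<tau> where "\<tau> k = real_of_ereal (t k)" for k
    have \<tau>: "t k = ereal (\<tau> k)" for k
      using B[of k] t_nonneg[of k] unfolding \<tau>_def by (cases "t k") auto
    have inc: "incseq \<tau>" using t_inc by (simp add: \<tau> incseq_def)
    have "\<tau> k \<le> B" for k using B[of k] by (simp add: \<tau>)
    then obtain T where T: "\<tau> \<longlonglongrightarrow> T" using incseq_convergent[OF inc] by blast
    have mono: "j \<le> k \<Longrightarrow> \<tau> j \<le> \<tau> k" for j k using inc by (simp add: incseqD)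
    from piece[OF \<tau>] obtain \<zeta> \<nu> where
      reg: "\<And>k. strong_regularity \<Omega> {\<tau> k..} (\<zeta> k) (\<nu> k)" and
      eq: "\<And>k. sampled_wave_equation_on \<Omega> \<alpha> (\<tau> k) {\<tau> k..} (\<zeta> k) (\<nu> k)" and
      ae: "\<And>k s. \<tau> k \<le> s \<Longrightarrow> s \<le> \<tau> (Suc k) \<Longrightarrow> ae_eq \<Omega> (\<zeta> k s) (z s) \<and> ae_eq \<Omega> (\<nu> k s) (v s)" and
      ev: "\<And>k. next_event \<Omega> \<gamma> (\<tau> k) (\<zeta> k) (\<nu> k) = ereal (\<tau> (Suc k))"
      unfolding \<tau> ereal_less_eq by metis
    have w: "wave_on \<Omega> {\<tau> k..} (\<lambda>x. - \<alpha> *\<^sub>R \<nu> k (\<tau> k) x) (\<zeta> k) (\<nu> k)" for k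
      by (rule sampled_wave_imp_wave_on[OF reg _ eq]) simp
    define U where "U k s = wave_state \<Omega> (\<zeta> k s) (\<nu> k s)" for k s
    note d = wave_on_D[OF w, simplified]
    have v_le: "L2_norm \<Omega> (\<nu> k (\<tau> k)) \<le> L2_norm \<Omega> (U k (\<tau> k))" for k
      unfolding U_def wave_state_def by (intro L2_norm_fst_le_Pair in_H1_L2(2) d) simp_all
    have f_le: "L2_norm \<Omega> (\<lambda>x. - \<alpha> *\<^sub>R \<nu> k (\<tau> k) x) \<le> \<alpha> * L2_norm \<Omega> (U k (\<tau> k))" for k
      using mult_left_mono[OF v_le[of k], of \<alpha>] assms(2) by (simp only: L2_norm_scaleR) simp
    \<comment> \<open>Both prolongations agree with z and v at the common instant: piece k at its
      right end, which the solution concept includes, and piece k + 1 at its left end.\<close>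
    have glue: "AE x in lebesgue_on \<Omega>. U k (\<tau> (Suc k)) x = U (Suc k) (\<tau> (Suc k)) x" for k
    proof -
      have "ae_eq \<Omega> (\<zeta> k (\<tau> (Suc k))) (z (\<tau> (Suc k)))" "ae_eq \<Omega> (\<nu> k (\<tau> (Suc k))) (v (\<tau> (Suc k)))"
        "ae_eq \<Omega> (\<zeta> (Suc k) (\<tau> (Suc k))) (z (\<tau> (Suc k)))" "ae_eq \<Omega> (\<nu> (Suc k) (\<tau> (Suc k))) (v (\<tau> (Suc k)))"
        using ae[of k "\<tau> (Suc k)"] ae[of "Suc k" "\<tau> (Suc k)"] mono[of k "Suc k"] mono[of "Suc k" "Suc (Suc k)"]
        by auto
      then have z: "ae_eq \<Omega> (\<zeta> k (\<tau> (Suc k))) (\<zeta> (Suc k) (\<tau> (Suc k)))"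
        and v: "AE x in lebesgue_on \<Omega>. \<nu> k (\<tau> (Suc k)) x = \<nu> (Suc k) (\<tau> (Suc k)) x"
        unfolding ae_eq_def by (auto elim: AE_mp)
      have "AE x in lebesgue_on \<Omega>. grad \<Omega> (\<zeta> k (\<tau> (Suc k))) x = grad \<Omega> (\<zeta> (Suc k) (\<tau> (Suc k))) x"
        by (rule grad_cong_AE[OF _ _ z]) (use mono[of k "Suc k"] in \<open>simp_all add: d(2)\<close>)
      with v show ?thesis by eventually_elim (simp add: U_def wave_state_def)
    qed
    show False
    proof (rule no_finite_accumulation[of \<tau> T \<alpha> "sqrt \<gamma>" \<Omega> U])
      show "0 < L2_norm \<Omega> (U k (\<tau> k))" for k
      proof (rule ccontr)
        assume "\<not> ?thesis"
        then have "L2_norm \<Omega> (wave_state \<Omega> (\<zeta> k (\<tau> k)) (\<nu> k (\<tau> k))) = 0"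
          using L2_norm_nonneg[of \<Omega> "U k (\<tau> k)"] unfolding U_def by linarith
        from next_event_of_rest[OF w assms(3) this] show False by (simp add: ev)
      qed
      show "in_L2 \<Omega> (U k s)" if "\<tau> k \<le> s" for k s unfolding U_def by (rule d(7)[OF that])
      show "continuous_on {\<tau> k..} (\<lambda>s. L2_norm \<Omega> (\<lambda>x. U k s x - U k r x))" if "\<tau> k \<le> r" for k r
        unfolding U_def by (rule wave_on_continuous_on[OF w d(7)[OF that]])
      show "\<bar>L2_norm \<Omega> (U k s) - L2_norm \<Omega> (U k (\<tau> k))\<bar> \<le> \<alpha> * (s - \<tau> k) * L2_norm \<Omega> (U k (\<tau> k))"
        if s: "\<tau> k \<le> s" for k s
      proof -
        have "\<bar>L2_norm \<Omega> (U k s) - L2_norm \<Omega> (U k (\<tau> k))\<bar>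
           \<le> L2_norm \<Omega> (\<lambda>x. - \<alpha> *\<^sub>R \<nu> k (\<tau> k) x) * \<bar>s - \<tau> k\<bar>"
          unfolding U_def by (rule wave_norm_Lipschitz[OF w]) (use s in auto)
        also have "\<dots> \<le> (\<alpha> * L2_norm \<Omega> (U k (\<tau> k))) * \<bar>s - \<tau> k\<bar>"
          by (intro mult_right_mono f_le) simp
        finally show ?thesis using s by (simp add: mult_ac)
      qed
      show "L2_norm \<Omega> (\<lambda>x. U j s x - U k s x) \<le> L2_norm \<Omega> (\<lambda>x. U j (\<tau> j) x - U k (\<tau> j) x)
          + \<alpha> * (s - \<tau> j) * (L2_norm \<Omega> (U j (\<tau> j)) + L2_norm \<Omega> (U k (\<tau> k)))"
        if jk: "k \<le> j" and s: "\<tau> j \<le> s" for j k s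
      proof -
        let ?f = "\<lambda>k x. - \<alpha> *\<^sub>R \<nu> k (\<tau> k) x"
        have wk: "wave_on \<Omega> {\<tau> j..} (?f k) (\<zeta> k) (\<nu> k)"
          by (rule wave_on_subset[OF w]) (use mono[OF jk] in auto)
        have "\<bar>L2_norm \<Omega> (\<lambda>x. U j s x - U k s x) - L2_norm \<Omega> (\<lambda>x. U j (\<tau> j) x - U k (\<tau> j) x)\<bar>
           \<le> L2_norm \<Omega> (\<lambda>x. ?f j x - ?f k x) * \<bar>s - \<tau> j\<bar>"
          unfolding U_def by (rule wave_norm_diff_Lipschitz[OF w wk]) (use s in auto)
        also have "L2_norm \<Omega> (\<lambda>x. ?f j x - ?f k x) \<le> L2_norm \<Omega> (?f j) + L2_norm \<Omega> (?f k)"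
          by (intro L2_norm_triangle_diff in_L2_scaleR d(5)) simp_all
        also have "\<dots> \<le> \<alpha> * (L2_norm \<Omega> (U j (\<tau> j)) + L2_norm \<Omega> (U k (\<tau> k)))"
          using f_le[of j] f_le[of k] by (simp only: distrib_left)
        finally show ?thesis using s by (simp add: mult_ac mult_right_mono)
      qed
      show "AE x in lebesgue_on \<Omega>. U k (\<tau> (Suc k)) x = U (Suc k) (\<tau> (Suc k)) x" for k by (rule glue)
      show "sqrt \<gamma> * L2_norm \<Omega> (U (Suc k) (\<tau> (Suc k))) \<le> L2_norm \<Omega> (\<lambda>x. U k (\<tau> (Suc k)) x - U k (\<tau> k) x)" for k
      proof -
        have "L2_norm \<Omega> (U (Suc k) (\<tau> (Suc k))) = L2_norm \<Omega> (U k (\<tau> (Suc k)))"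
          unfolding U_def
          by (rule L2_norm_cong_AE[OF d(7) d(7)])
             (use glue[of k] mono[of k "Suc k"] in \<open>auto simp: U_def elim!: eventually_mono\<close>)
        also have "sqrt \<gamma> * \<dots> \<le> L2_norm \<Omega> (\<lambda>x. \<nu> k (\<tau> (Suc k)) x - \<nu> k (\<tau> k) x)"
          unfolding U_def by (rule error_at_next_event[OF w assms(3) ev])
        \<comment> \<open>The velocity error is the first component of the jump of the
          state.\<close>
        also have "\<dots> \<le> L2_norm \<Omega> (\<lambda>x. U k (\<tau> (Suc k)) x - U k (\<tau> k) x)"
          unfolding U_def wave_state_def diff_Pair
          by (intro L2_norm_fst_le_Pair in_L2_diff in_H1_L2(2) d mono) simp_all
        finally show ?thesis .
      qed
    qed (use inc T assms(2,3) in auto)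
  qed
  have "finite {k. t k \<le> ereal B}" for B
  proof -
    obtain k where "ereal B < t k" using unbounded by blast
    then have "ereal B < t j" if "k \<le> j" for j
      using incseqD[OF t_inc that] by (rule less_le_trans)
    then have "{j. t j \<le> ereal B} \<subseteq> {..<k}" by (auto simp flip: not_le)
    then show ?thesis by (rule finite_subset) simp
  qed
  moreover have "maximal_time t = \<infinity>"
  proof -
    \<comment> \<open>Padding by \<infinity> makes the limsup \<infinity> for finite sequences too,
      so both branches of \<open>maximal_time\<close> agree.\<close>
    have "(SUP k. t k) = \<infinity>"
      by (rule SUP_PInfty) (use unbounded less_imp_le in blast)
    then have "limsup t = \<infinity>"
      using LIMSEQ_SUP[OF t_inc] by (intro lim_imp_Limsup) auto
    then show ?thesis by (simp add: maximal_time_def)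
  qed
  ultimately show ?thesis by (simp add: zeno_def)
qed

end
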